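(* Let $\varphi$ be a uniformly continuous endomorphism (with respect to $d_2$) of a finitely generated virtually free group $G$, and let $\Phi$ be its continuous extension to $\widehat{L}$. Then $\operatorname{Reg}\Phi$ has finitely many $(\operatorname{Fix}\varphi)$-orbits.
   Context: Maps are written on the right. For a finite alphabet $A$, $A^{-1}$ is a disjoint set of formal inverses, $\widetilde{A}=A\cup A^{-1}$, and $a\mapsto a^{-1}$ extends to an involution of $\widetilde{A}^*$ with $(uv)^{-1}=v^{-1}u^{-1}$. $|u|$ is the length of $u$. For finite or (right) infinite words $\alpha,\beta$, $\alpha\wedge\beta$ is the longest common prefix, and $\alpha^{[n]}$ is the prefix of length $n$ of $\alpha$ ($\alpha^{[n]}=\alpha$ if $n>|\alpha|$). A homomorphism $\pi:\widetilde{A}^*\to G$ is matched if $a^{-1}\pi=(a\pi)^{-1}$ for $a\in A$. Setting. $G$ is a finitely generated virtually free group, $A$ is a finite alphabet, $\pi:\widetilde{A}^*\to G$ a matched epimorphism; $d_1(g,h)$ is the least length of a word $u\in\widetilde{A}^*$ with $g(u\pi)=h$; $\mathrm{Geo}_A(G)=\{u\in\widetilde{A}^*: |u|=d_1(1,u\pi)\}$. $A$, $\pi$ and a positive integer $N_0$ are fixed so that for all $u\in\mathrm{Geo}_A(G)$, $v\in\widetilde{A}^*$: there is $w\in\mathrm{Geo}_A(G)$ with $w\pi=(uv)\pi$ and $|u\wedge w|\ge|u|-N_0|v|$, and there is $z\in\mathrm{Geo}_A(G)$ with $z\pi=(vu)\pi$ and $|u^{-1}\wedge z^{-1}|\ge|u|-N_0|v|$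 (such $A,\pi,N_0$ exist for every finitely generated virtually free group). Fix a total order on $\widetilde{A}$ and let $\le_{sl}$ be the induced shortlex order on $\widetilde{A}^*$ (compare by length first, then lexicographically). Let $L=\{u\in\mathrm{Geo}_A(G): u\le_{sl}v \text{ for every } v\in\widetilde{A}^* \text{ with } v\pi=u\pi\}$. For $g\in G$, $\overline{g}$ is the unique word of $L$ representing $g$; for $u\in\widetilde{A}^*$, $\overline{u}=\overline{u\pi}$. $L$ is a group under $(u,v)\mapsto\overline{uv}$, isomorphic to $G$ via $\pi$. The metric $d_2$ on $G$. $(g|h)=\frac12(d_1(1,g)+d_1(1,h)-d_1(g,h))$. Let $\delta\ge0$ be such that the Cayley graph of $G$ with respect to $\pi$ is $\delta$-hyperbolic (for each geodesic triangle, every vertex on one side is at $d_1$-distance $<\delta$ from the set of vertices of the other two sides). Fix $\varepsilon>0$ with $\varepsilon\delta\le\frac15$ and let $z=e^{\varepsilon}$; $\rho(g,h)=z^{-(g|h)}$ if $g\neq h$ and $\rho(g,g)=0$; $d_2(g,h)=\inf\{\rho(g_0,g_1)+\dots+\rho(g_{n-1},g_n): g_0=g,\ g_n=h,\ g_1,\dots,g_{n-1}\in G\}$. The model of the completion. $\partial L=\{\alpha\in\widetilde{A}^{\omega}: \alpha^{[n]}\in L\text{ for all }n\}$ (a set of right infinite words), $\widehat{L}=L\cup\partial L$, with the metric $d_3(\alpha,\beta)=2^{-|\alpha\wedge\beta|}$ if $\alpha\ne\beta$ and $d_3(\alpha,\alpha)=0$. The map $g\mapsto\overline g$ is a uniform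 isomorphism $(G,d_2)\to(L,d_3)$, $(\widehat{L},d_3)$ is the completion of $(L,d_3)$, and $\partial L$ is homeomorphic to the hyperbolic boundary of $G$. For $u\in L$, the map $L\to L$, $v\mapsto\overline{uv}$ extends continuously to $\widehat{L}$; write $\alpha\mapsto\overline{u\alpha}$ for the extension. This gives a left action of $L\cong G$ on $\partial L$. For a uniformly continuous endomorphism $\varphi$ of $(G,d_2)$, $\overline{\varphi}:L\to L$ is $u\overline{\varphi}=\overline{(u\pi)\varphi}$, and $\Phi:\widehat{L}\to\widehat{L}$ is its unique continuous extension. $\operatorname{Fix}\varphi=\{g\in G: g\varphi=g\}$ (identified with $\operatorname{Fix}\overline{\varphi}\subseteq L$) and $\operatorname{Fix}\Phi=\{\alpha\in\widehat L:\alpha\Phi=\alpha\}$. A point $\alpha\in\operatorname{Fix}\Phi\cap\partial L$ is singular if it lies in the topological closure of $\operatorname{Fix}\overline\varphi$ in $\widehat{L}$, and regular otherwise; $\operatorname{Reg}\Phi$ is the set of regular points. The left action of $G$ on $\partial L$ restricts to an action of $\operatorname{Fix}\varphi$ on $\operatorname{Reg}\Phi$; the orbits in the claim are for this action. *)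

theory Defs
  imports
    "HOL-Analysis.Analysis"
    "HOL-Algebra.Group_Action"
    "HOL-Algebra.Generated_Groups"
    "HOL-Library.Sublist"
    "HOL-Library.Stream"
begin

section \<open>Words with formal inverses\<close>

text \<open>The letter \<open>(a, True)\<close> stands for \<open>a\<close> and \<open>(a, False)\<close> for its formal inverse.
  Maps are written on the left throughout, but products in groups and concatenation of words are
  read from left to right as usual.\<close>

definition letters :: "'a set \<Rightarrow> ('a \<times> bool) set"
  where "letters A = A \<times> UNIV"

definition linv :: "'a \<times> bool \<Rightarrow> 'a \<times> bool"
  where "linv x = (fst x, \<not> snd x)"

definition winv :: "('a \<times> bool) list \<Rightarrow> ('a \<times> bool) list"
  where "winv u = rev (map linv u)"

abbreviation words :: "'a set \<Rightarrow> ('a \<times> bool) list set"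
  where "words A \<equiv> lists (letters A)"

definition matched_epi ::
  "('g, 'm) monoid_scheme \<Rightarrow> 'a set \<Rightarrow> (('a \<times> bool) list \<Rightarrow> 'g) \<Rightarrow> bool"
  where "matched_epi G A \<pi> \<longleftrightarrow>
    \<pi> [] = \<one>\<^bsub>G\<^esub> \<and>
    (\<forall>u\<in>words A. \<forall>v\<in>words A. \<pi> (u @ v) = \<pi> u \<otimes>\<^bsub>G\<^esub> \<pi> v) \<and>
    (\<forall>a\<in>A. \<pi> [(a, False)] = inv\<^bsub>G\<^esub> (\<pi> [(a, True)])) \<and>
    \<pi> ` words A = carrier G"


section \<open>Finitely generated virtually free groups\<close>

definition finitely_generated :: "('g, 'm) monoid_scheme \<Rightarrow> bool"
  where "finitely_generated G \<longleftrightarrow>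
    (\<exists>S. finite S \<and> S \<subseteq> carrier G \<and> generate G S = carrier G)"

definition reduced :: "('a \<times> bool) list \<Rightarrow> bool"
  where "reduced w \<longleftrightarrow> (\<forall>i. Suc i < length w \<longrightarrow> w ! Suc i \<noteq> linv (w ! i))"

definition eval_word :: "('g, 'm) monoid_scheme \<Rightarrow> ('g \<times> bool) list \<Rightarrow> 'g"
  where "eval_word G w =
    foldr (\<lambda>(s, b) x. (if b then s else inv\<^bsub>G\<^esub> s) \<otimes>\<^bsub>G\<^esub> x) w \<one>\<^bsub>G\<^esub>"

definition free_basis :: "('g, 'm) monoid_scheme \<Rightarrow> 'g set \<Rightarrow> bool"
  where "free_basis G S \<longleftrightarrow> S \<subseteq> carrier G \<and>
    (\<forall>g\<in>carrier G. \<exists>!w. w \<in> words S \<and> reduced w \<and> eval_word G w = g)"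

definition virtually_free :: "('g, 'm) monoid_scheme \<Rightarrow> bool"
  where "virtually_free G \<longleftrightarrow>
    (\<exists>H. subgroup H G \<and> finite (rcosets\<^bsub>G\<^esub> H) \<and> (\<exists>S. free_basis (G\<lparr>carrier := H\<rparr>) S))"


section \<open>The Cayley graph and its geodesics\<close>

definition d1 ::
  "('g, 'm) monoid_scheme \<Rightarrow> 'a set \<Rightarrow> (('a \<times> bool) list \<Rightarrow> 'g) \<Rightarrow> 'g \<Rightarrow> 'g \<Rightarrow> nat"
  where "d1 G A \<pi> g h = (LEAST n. \<exists>u\<in>words A. length u = n \<and> g \<otimes>\<^bsub>G\<^esub> \<pi> u = h)"

definition Geo ::
  "('g, 'm) monoid_scheme \<Rightarrow> 'a set \<Rightarrow> (('a \<times> bool) list \<Rightarrow> 'g) \<Rightarrow> ('a \<times> bool) list set"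
  where "Geo G A \<pi> = {u \<in> words A. length u = d1 G A \<pi> \<one>\<^bsub>G\<^esub> (\<pi> u)}"

text \<open>The lower bounds \<open>\<bar>u \<and> w\<bar> \<ge> \<bar>u\<bar> - N \<bar>v\<bar>\<close> are written without
  subtraction.\<close>

definition bounded_reduction ::
  "('g, 'm) monoid_scheme \<Rightarrow> 'a set \<Rightarrow> (('a \<times> bool) list \<Rightarrow> 'g) \<Rightarrow> nat \<Rightarrow> bool"
  where "bounded_reduction G A \<pi> N \<longleftrightarrow>
    (\<forall>u\<in>Geo G A \<pi>. \<forall>v\<in>words A.
      (\<exists>w\<in>Geo G A \<pi>. \<pi> w = \<pi> (u @ v) \<and>
         length u \<le> length (longest_common_prefix u w) + N * length v) \<and>
      (\<exists>z\<in>Geo G A \<pi>. \<pi> z = \<pi> (v @ u) \<and>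
         length u \<le> length (longest_common_prefix (winv u) (winv z)) + N * length v))"

text \<open>A geodesic is given by the list of vertices it visits.\<close>

definition geodesic ::
  "('g, 'm) monoid_scheme \<Rightarrow> 'a set \<Rightarrow> (('a \<times> bool) list \<Rightarrow> 'g) \<Rightarrow> 'g \<Rightarrow> 'g \<Rightarrow> 'g list \<Rightarrow> bool"
  where "geodesic G A \<pi> g h p \<longleftrightarrow>
    set p \<subseteq> carrier G \<and> length p = d1 G A \<pi> g h + 1 \<and> hd p = g \<and> last p = h \<and>
    (\<forall>i. Suc i < length p \<longrightarrow> (\<exists>x\<in>letters A. p ! Suc i = p ! i \<otimes>\<^bsub>G\<^esub> \<pi> [x]))"

text \<open>The condition is cyclically symmetric in the three sides, so it suffices to
  state it for the vertices of the side \<open>p\<close>.\<close>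

definition hyperbolic ::
  "('g, 'm) monoid_scheme \<Rightarrow> 'a set \<Rightarrow> (('a \<times> bool) list \<Rightarrow> 'g) \<Rightarrow> real \<Rightarrow> bool"
  where "hyperbolic G A \<pi> \<delta> \<longleftrightarrow>
    (\<forall>g h k p q r. geodesic G A \<pi> g h p \<and> geodesic G A \<pi> h k q \<and> geodesic G A \<pi> k g r \<longrightarrow>
      (\<forall>x\<in>set p. \<exists>y\<in>set q \<union> set r. real (d1 G A \<pi> x y) < \<delta>))"


section \<open>The visual metric\<close>

definition gromov_product ::
  "('g, 'm) monoid_scheme \<Rightarrow> 'a set \<Rightarrow> (('a \<times> bool) list \<Rightarrow> 'g) \<Rightarrow> 'g \<Rightarrow> 'g \<Rightarrow> real"
  where "gromov_product G A \<pi> g h =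
    (real (d1 G A \<pi> \<one>\<^bsub>G\<^esub> g) + real (d1 G A \<pi> \<one>\<^bsub>G\<^esub> h) - real (d1 G A \<pi> g h)) / 2"

definition rho ::
  "('g, 'm) monoid_scheme \<Rightarrow> 'a set \<Rightarrow> (('a \<times> bool) list \<Rightarrow> 'g) \<Rightarrow> real \<Rightarrow> 'g \<Rightarrow> 'g \<Rightarrow> real"
  where "rho G A \<pi> \<epsilon> g h =
    (if g = h then 0 else exp \<epsilon> powr (- gromov_product G A \<pi> g h))"

definition chain_sum :: "('g \<Rightarrow> 'g \<Rightarrow> real) \<Rightarrow> 'g list \<Rightarrow> real"
  where "chain_sum f xs = (\<Sum>i<length xs - 1. f (xs ! i) (xs ! Suc i))"

definition d2 ::
  "('g, 'm) monoid_scheme \<Rightarrow> 'a set \<Rightarrow> (('a \<times> bool) list \<Rightarrow> 'g) \<Rightarrow> real \<Rightarrow> 'g \<Rightarrow> 'g \<Rightarrow> real"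
  where "d2 G A \<pi> \<epsilon> g h =
    Inf {chain_sum (rho G A \<pi> \<epsilon>) (g # gs @ [h]) | gs. gs \<in> lists (carrier G)}"

definition unif_continuous :: "'g set \<Rightarrow> ('g \<Rightarrow> 'g \<Rightarrow> real) \<Rightarrow> ('g \<Rightarrow> 'g) \<Rightarrow> bool"
  where "unif_continuous X d f \<longleftrightarrow>
    (\<forall>e>0. \<exists>c>0. \<forall>x\<in>X. \<forall>y\<in>X. d x y < c \<longrightarrow> d (f x) (f y) < e)"


section \<open>Shortlex normal forms\<close>

text \<open>The order on the letters is a reflexive relation \<open>R\<close>, whereas \<^const>\<open>lenlex\<close> expects a
  strict one.\<close>

definition shortlex_le :: "('b \<times> 'b) set \<Rightarrow> 'b list \<Rightarrow> 'b list \<Rightarrow> bool"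
  where "shortlex_le R u v \<longleftrightarrow> u = v \<or> (u, v) \<in> lenlex (R - Id)"

definition nf_words ::
  "('g, 'm) monoid_scheme \<Rightarrow> 'a set \<Rightarrow> (('a \<times> bool) list \<Rightarrow> 'g) \<Rightarrow>
   (('a \<times> bool) \<times> ('a \<times> bool)) set \<Rightarrow> ('a \<times> bool) list set"
  where "nf_words G A \<pi> R =
    {u \<in> Geo G A \<pi>. \<forall>v\<in>words A. \<pi> v = \<pi> u \<longrightarrow> shortlex_le R u v}"

definition nf ::
  "('g, 'm) monoid_scheme \<Rightarrow> 'a set \<Rightarrow> (('a \<times> bool) list \<Rightarrow> 'g) \<Rightarrow>
   (('a \<times> bool) \<times> ('a \<times> bool)) set \<Rightarrow> 'g \<Rightarrow> ('a \<times> bool) list"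
  where "nf G A \<pi> R g = (THE u. u \<in> nf_words G A \<pi> R \<and> \<pi> u = g)"

lemma nf_unique:
  assumes "finite A" "linear_order_on (letters A) R" "matched_epi G A \<pi>" "g \<in> carrier G"
    and "group G"
  shows "\<exists>!u. u \<in> nf_words G A \<pi> R \<and> \<pi> u = g"
proof -
  interpret group G by fact
  have RA: "R \<subseteq> letters A \<times> letters A" "trans R" "antisym R" "total_on (letters A) R"
    using assms(2) by (auto simp: linear_order_on_def partial_order_on_def preorder_on_def)
  have "finite R"
    using RA(1) assms(1) by (auto simp: letters_def intro: finite_subset)
  moreover have "trans (R - Id)"
    using RA(2,3) by (rule trans_diff_Id)
  hence "acyclic (R - Id)"
    by (simp add: acyclic_def)
  ultimately have "wf (R - Id)"
    by (simp add: finite_acyclic_wf)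
  hence wf: "wf (lenlex (R - Id))"
    by (rule wf_lenlex)
  have lex_total: "(u, v) \<in> lex (R - Id) \<or> u = v \<or> (v, u) \<in> lex (R - Id)"
    if "length u = length v" "u \<in> words A" "v \<in> words A" for u v
    using that RA(4) by (induction u v rule: list_induct2) (auto simp: total_on_def)
  have tot: "(u, v) \<in> lenlex (R - Id) \<or> u = v \<or> (v, u) \<in> lenlex (R - Id)"
    if "u \<in> words A" "v \<in> words A" for u v
    using that lex_total[of u v] by (auto simp: lenlex_conv)
  define W where "W = {u \<in> words A. \<pi> u = g}"
  have "W \<noteq> {}"
  proof -
    have "g \<in> \<pi> ` words A" using assms(3,4) by (simp add: matched_epi_def)
    thus ?thesis by (auto simp: W_def)
  qed
  then obtain u where u: "u \<in> W" "\<And>v. (v, u) \<in> lenlex (R - Id) \<Longrightarrow> v \<notin> W"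
    using wf by (metis wfE_min ex_in_conv)
  have le: "shortlex_le R u v" if "v \<in> W" for v
    using tot[of u v] u that by (auto simp: W_def shortlex_le_def)
  have d1: "d1 G A \<pi> \<one>\<^bsub>G\<^esub> (\<pi> u) = length u"
    unfolding d1_def
  proof (rule Least_equality)
    show "\<exists>v\<in>words A. length v = length u \<and> \<one>\<^bsub>G\<^esub> \<otimes>\<^bsub>G\<^esub> \<pi> v = \<pi> u"
      using u(1) assms(4) by (auto simp: W_def)
  next
    fix n assume "\<exists>v\<in>words A. length v = n \<and> \<one>\<^bsub>G\<^esub> \<otimes>\<^bsub>G\<^esub> \<pi> v = \<pi> u"
    then obtain v where v: "v \<in> words A" "length v = n" "\<one>\<^bsub>G\<^esub> \<otimes>\<^bsub>G\<^esub> \<pi> v = \<pi> u"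
      by blast
    moreover have "\<pi> v \<in> carrier G"
      using v(1) assms(3) by (auto simp: matched_epi_def)
    ultimately have "v \<in> W"
      using u(1) by (simp add: W_def)
    from le[OF this] show "length u \<le> n"
      using v(2) by (auto simp: shortlex_le_def lenlex_conv)
  qed
  have "u \<in> nf_words G A \<pi> R \<and> \<pi> u = g"
    using u(1) d1 le by (auto simp: nf_words_def Geo_def W_def)
  moreover have "v = u" if "v \<in> nf_words G A \<pi> R \<and> \<pi> v = g" for v
  proof -
    have "v \<in> W" "shortlex_le R v u"
      using that u(1) by (auto simp: nf_words_def Geo_def W_def)
    with u(2) show ?thesis
      by (auto simp: shortlex_le_def)
  qed
  ultimately show ?thesis by blast
qed


section \<open>Finite and infinite words\<close>

datatype 'b fiword = FinWord "'b list" | InfWord "'b stream"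

fun prefix_of :: "'b list \<Rightarrow> 'b fiword \<Rightarrow> bool"
  where
    "prefix_of w (FinWord u) \<longleftrightarrow> prefix w u"
  | "prefix_of w (InfWord s) \<longleftrightarrow> w = stake (length w) s"

text \<open>The length of the longest common prefix; meaningful if \<open>\<alpha> \<noteq> \<beta>\<close>.\<close>

definition lcp_length :: "'b fiword \<Rightarrow> 'b fiword \<Rightarrow> nat"
  where "lcp_length \<alpha> \<beta> =
    (GREATEST n. \<exists>w. length w = n \<and> prefix_of w \<alpha> \<and> prefix_of w \<beta>)"

definition d3 :: "'b fiword \<Rightarrow> 'b fiword \<Rightarrow> real"
  where "d3 \<alpha> \<beta> = (if \<alpha> = \<beta> then 0 else (1 / 2) ^ lcp_length \<alpha> \<beta>)"

lemma prefix_of_comparable: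
  assumes "prefix_of v \<alpha>" "prefix_of w \<alpha>" "length v \<le> length w"
  shows "prefix v w"
proof (cases \<alpha>)
  case (FinWord u)
  thus ?thesis using assms by (auto intro: prefix_length_prefix)
next
  case (InfWord s)
  hence "v = take (length v) w"
    using assms by (metis min.absorb1 prefix_of.simps(2) take_stake)
  thus ?thesis by (metis take_is_prefix)
qed

lemma prefix_of_trans:
  assumes "prefix v w" "prefix_of w \<alpha>"
  shows "prefix_of v \<alpha>"
proof (cases \<alpha>)
  case (FinWord u)
  thus ?thesis using assms by auto
next
  case (InfWord s)
  have "length v \<le> length w" using assms(1) by (rule prefix_length_le)
  moreover have "v = take (length v) w" using assms(1) by (auto simp: prefix_def)
  ultimately show ?thesis
    using assms(2) InfWord by (metis min.absorb1 prefix_of.simps(2) take_stake)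
qed

lemma common_prefix_bounded:
  assumes "\<alpha> \<noteq> \<beta>"
  shows "\<exists>b. \<forall>w. prefix_of w \<alpha> \<and> prefix_of w \<beta> \<longrightarrow> length w \<le> b"
proof (cases "\<exists>u. \<alpha> = FinWord u \<or> \<beta> = FinWord u")
  case True
  thus ?thesis by (auto dest!: prefix_length_le)
next
  case False
  then obtain s t where st: "\<alpha> = InfWord s" "\<beta> = InfWord t"
    by (metis fiword.exhaust)
  with assms have "s \<noteq> t" by auto
  then obtain n where n: "s !! n \<noteq> t !! n"
    by (metis ext stream_smap_nats)
  have "length w \<le> n" if "w = stake (length w) s" "w = stake (length w) t" for w
    using that n by (metis leI stake_nth)
  thus ?thesis using st by auto
qed

lemma lcp_length_attained:
  assumes "\<alpha> \<noteq> \<beta>"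
  shows "\<exists>w. length w = lcp_length \<alpha> \<beta> \<and> prefix_of w \<alpha> \<and> prefix_of w \<beta>"
proof -
  obtain b where "\<forall>w. prefix_of w \<alpha> \<and> prefix_of w \<beta> \<longrightarrow> length w \<le> b"
    using common_prefix_bounded[OF assms] by blast
  moreover have "prefix_of [] \<alpha>" "prefix_of [] \<beta>"
    by (cases \<alpha>; simp) (cases \<beta>; simp)
  ultimately show ?thesis
    unfolding lcp_length_def
    by (intro GreatestI_nat[where k = 0 and b = b and
          P = "\<lambda>n. \<exists>w. length w = n \<and> prefix_of w \<alpha> \<and> prefix_of w \<beta>"]) auto
qed

lemma lcp_length_ge:
  assumes "\<alpha> \<noteq> \<beta>" "prefix_of w \<alpha>" "prefix_of w \<beta>"
  shows "length w \<le> lcp_length \<alpha> \<beta>"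
proof -
  obtain b where "\<forall>w. prefix_of w \<alpha> \<and> prefix_of w \<beta> \<longrightarrow> length w \<le> b"
    using common_prefix_bounded[OF assms(1)] by blast
  thus ?thesis
    unfolding lcp_length_def using assms(2,3)
    by (intro Greatest_le_nat[where b = b]) auto
qed

lemma d3_ultrametric: "d3 \<alpha> \<gamma> \<le> max (d3 \<alpha> \<beta>) (d3 \<beta> \<gamma>)"
proof (cases "\<alpha> = \<beta> \<or> \<beta> = \<gamma> \<or> \<alpha> = \<gamma>")
  case True
  thus ?thesis by (auto simp: d3_def max_def)
next
  case False
  obtain v where v: "length v = lcp_length \<alpha> \<beta>" "prefix_of v \<alpha>" "prefix_of v \<beta>"
    using lcp_length_attained False by blast
  obtain w where w: "length w = lcp_length \<beta> \<gamma>" "prefix_of w \<beta>" "prefix_of w \<gamma>"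
    using lcp_length_attained False by blast
  show ?thesis
  proof (cases "length v \<le> length w")
    case True
    hence "prefix_of v \<gamma>"
      using prefix_of_comparable prefix_of_trans v(3) w by blast
    hence "lcp_length \<alpha> \<beta> \<le> lcp_length \<alpha> \<gamma>"
      using lcp_length_ge False v by metis
    hence "(1 / 2 :: real) ^ lcp_length \<alpha> \<gamma> \<le> (1 / 2) ^ lcp_length \<alpha> \<beta>"
      by (intro power_decreasing) auto
    thus ?thesis using False by (simp add: d3_def le_max_iff_disj)
  next
    case wv: False
    hence "prefix_of w \<alpha>"
      using prefix_of_comparable prefix_of_trans v w by (meson nat_le_linear)
    hence "lcp_length \<beta> \<gamma> \<le> lcp_length \<alpha> \<gamma>"
      using lcp_length_ge False w by metis
    hence "(1 / 2 :: real) ^ lcp_length \<alpha> \<gamma> \<le> (1 / 2) ^ lcp_length \<beta> \<gamma>"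
      by (intro power_decreasing) auto
    thus ?thesis using False by (simp add: d3_def le_max_iff_disj)
  qed
qed

lemma Metric_space_d3: "Metric_space M d3"
proof
  show nonneg: "0 \<le> d3 \<alpha> \<beta>" for \<alpha> \<beta> :: "'a fiword"
    by (simp add: d3_def)
  show "d3 \<alpha> \<beta> = d3 \<beta> \<alpha>" for \<alpha> \<beta> :: "'a fiword"
    by (auto simp: d3_def lcp_length_def conj_commute)
  show "d3 \<alpha> \<beta> = 0 \<longleftrightarrow> \<alpha> = \<beta>" for \<alpha> \<beta> :: "'a fiword"
    by (simp add: d3_def)
  show "d3 \<alpha> \<gamma> \<le> d3 \<alpha> \<beta> + d3 \<beta> \<gamma>" for \<alpha> \<beta> \<gamma> :: "'a fiword"
    using d3_ultrametric[of \<alpha> \<gamma> \<beta>] nonneg[of \<alpha> \<beta>] nonneg[of \<beta> \<gamma>] by linarith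
qed


section \<open>The model of the completion\<close>

definition boundary ::
  "('g, 'm) monoid_scheme \<Rightarrow> 'a set \<Rightarrow> (('a \<times> bool) list \<Rightarrow> 'g) \<Rightarrow>
   (('a \<times> bool) \<times> ('a \<times> bool)) set \<Rightarrow> ('a \<times> bool) fiword set"
  where "boundary G A \<pi> R = {InfWord s | s. \<forall>n. stake n s \<in> nf_words G A \<pi> R}"

definition Lhat ::
  "('g, 'm) monoid_scheme \<Rightarrow> 'a set \<Rightarrow> (('a \<times> bool) list \<Rightarrow> 'g) \<Rightarrow>
   (('a \<times> bool) \<times> ('a \<times> bool)) set \<Rightarrow> ('a \<times> bool) fiword set"
  where "Lhat G A \<pi> R = FinWord ` nf_words G A \<pi> R \<union> boundary G A \<pi> R"

definition Lhat_topology ::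
  "('g, 'm) monoid_scheme \<Rightarrow> 'a set \<Rightarrow> (('a \<times> bool) list \<Rightarrow> 'g) \<Rightarrow>
   (('a \<times> bool) \<times> ('a \<times> bool)) set \<Rightarrow> ('a \<times> bool) fiword topology"
  where "Lhat_topology G A \<pi> R = Metric_space.mtopology (Lhat G A \<pi> R) d3"

definition continuous_extension ::
  "('g, 'm) monoid_scheme \<Rightarrow> 'a set \<Rightarrow> (('a \<times> bool) list \<Rightarrow> 'g) \<Rightarrow>
   (('a \<times> bool) \<times> ('a \<times> bool)) set \<Rightarrow>
   (('a \<times> bool) list \<Rightarrow> ('a \<times> bool) list) \<Rightarrow>
   (('a \<times> bool) fiword \<Rightarrow> ('a \<times> bool) fiword) \<Rightarrow> bool"
  where "continuous_extension G A \<pi> R f F \<longleftrightarrow>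
    continuous_map (Lhat_topology G A \<pi> R) (Lhat_topology G A \<pi> R) F \<and>
    (\<forall>u\<in>nf_words G A \<pi> R. F (FinWord u) = FinWord (f u))"

text \<open>A continuous extension is determined on \<^const>\<open>Lhat\<close> only, since HOL functions are total;
  the choice operator fixes irrelevant values elsewhere.\<close>

definition act ::
  "('g, 'm) monoid_scheme \<Rightarrow> 'a set \<Rightarrow> (('a \<times> bool) list \<Rightarrow> 'g) \<Rightarrow>
   (('a \<times> bool) \<times> ('a \<times> bool)) set \<Rightarrow> 'g \<Rightarrow>
   ('a \<times> bool) fiword \<Rightarrow> ('a \<times> bool) fiword"
  where "act G A \<pi> R g =
    (SOME F. continuous_extension G A \<pi> R (\<lambda>v. nf G A \<pi> R (\<pi> (nf G A \<pi> R g @ v))) F)"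


section \<open>Fixed points\<close>

definition nf_endo ::
  "('g, 'm) monoid_scheme \<Rightarrow> 'a set \<Rightarrow> (('a \<times> bool) list \<Rightarrow> 'g) \<Rightarrow>
   (('a \<times> bool) \<times> ('a \<times> bool)) set \<Rightarrow> ('g \<Rightarrow> 'g) \<Rightarrow>
   ('a \<times> bool) list \<Rightarrow> ('a \<times> bool) list"
  where "nf_endo G A \<pi> R \<phi> u = nf G A \<pi> R (\<phi> (\<pi> u))"

definition Fix :: "'b set \<Rightarrow> ('b \<Rightarrow> 'b) \<Rightarrow> 'b set"
  where "Fix X f = {x \<in> X. f x = x}"

definition Reg ::
  "('g, 'm) monoid_scheme \<Rightarrow> 'a set \<Rightarrow> (('a \<times> bool) list \<Rightarrow> 'g) \<Rightarrow>
   (('a \<times> bool) \<times> ('a \<times> bool)) set \<Rightarrow> ('g \<Rightarrow> 'g) \<Rightarrow>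
   (('a \<times> bool) fiword \<Rightarrow> ('a \<times> bool) fiword) \<Rightarrow> ('a \<times> bool) fiword set"
  where "Reg G A \<pi> R \<phi> \<Phi> =
    (Fix (Lhat G A \<pi> R) \<Phi> \<inter> boundary G A \<pi> R) -
    Lhat_topology G A \<pi> R closure_of
      (FinWord ` Fix (nf_words G A \<pi> R) (nf_endo G A \<pi> R \<phi>))"

lemma subgroup_Fix:
  assumes "group G" "\<phi> \<in> hom G G"
  shows "subgroup (Fix (carrier G) \<phi>) G"
proof -
  interpret group G by fact
  interpret group_hom G G \<phi>
    using assms by (simp add: group_hom_def group_hom_axioms_def)
  show ?thesis
    by unfold_locales (auto simp: Fix_def)
qed

end

theory Submission
  imports Defs
begin

text \<open>
  Bounded reduction makes the prefix tree of normal forms bilipschitz to the Cayley graph: right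
  multiplication by \<open>b\<close> changes at most the last \<open>N * len b\<close> letters of a normal form, so a path
  with bounded jumps can enter or leave a branch of the tree only near its root. Combined with the
  finiteness of the kernel (a uniformly continuous \<open>\<phi>\<close> with infinite kernel is trivial), this gives
  bounded cancellation: if \<open>s\<close> is a fixed boundary point with prefixes \<open>s\<^sub>n\<close>, then \<open>\<phi> s\<^sub>n\<close> stays at
  bounded distance from the ray \<open>s\<close>.

  In the spirit of Goldstein and Turner, put \<open>g\<^sub>n = s\<^sub>n\<^sup>-\<^sup>1 (\<phi> s\<^sub>n)\<close>. If \<open>g\<^sub>n = g\<^sub>m\<close> then
  \<open>s\<^sub>n s\<^sub>m\<^sup>-\<^sup>1\<close> is fixed, so for regular \<open>s\<close> the lengths of the \<open>g\<^sub>n\<close> tend to infinity. Hence there is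
  a last time at which \<open>g\<^sub>n\<close> lies in a given finite ball, and afterwards \<open>\<phi> s\<^sub>n\<close> either runs ahead of
  \<open>s\<^sub>n\<close> along the ray for ever, or lags behind it for ever. From then on the tail of \<open>s\<close> is determined by \<open>g\<^sub>n\<close>
  and by which of the two happens: in the first case \<open>g\<^sub>n\<close> spells the continuation of the ray, in
  the second case a bifurcation would contradict bounded cancellation. Two regular points with
  the same data differ by an element of \<open>Fix \<phi>\<close>.
\<close>

section \<open>Words, streams and the prefix metric\<close>

lemma switch_point:
  fixes a b :: nat
  assumes "a \<le> b" "P a" "\<not> P b"
  shows "\<exists>c. a \<le> c \<and> c < b \<and> P c \<and> \<not> P (Suc c)"
  using assms by (induction b rule: dec_induct) (auto, metis less_Suc_eq)

lemma lex_appendD: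
  "(a @ b, c @ d) \<in> lex r \<Longrightarrow> length a = length c \<Longrightarrow> a \<noteq> c \<Longrightarrow> (a, c) \<in> lex r"
proof (induction a arbitrary: c)
  case (Cons x a)
  then obtain y c' where "c = y # c'" by (cases c) auto
  with Cons show ?case by auto
qed simp

lemma take_eq_of_common_prefix:
  assumes "prefix p u" "prefix p v" "k \<le> length p"
  shows "take k u = take k v"
  using assms by (auto simp: prefix_def)

lemma stream_eq_iff_stake: "s = t \<longleftrightarrow> (\<forall>n. stake n s = stake n t)"
proof
  assume "\<forall>n. stake n s = stake n t"
  then have "s !! n = t !! n" for n
    by (metis lessI stake_nth)
  then show "s = t" by (metis ext stream_smap_nats)
qed simp

lemma prefix_of_stake_FinWord: "prefix_of (stake k s) (FinWord u) \<longleftrightarrow> take k u = stake k s"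
proof
  assume "prefix_of (stake k s) (FinWord u)"
  then show "take k u = stake k s" by (auto simp: prefix_def)
next
  assume "take k u = stake k s"
  then show "prefix_of (stake k s) (FinWord u)" by (metis prefix_of.simps(1) take_is_prefix)
qed

lemma d3_self [simp]: "d3 \<alpha> \<alpha> = 0"
  by (simp add: d3_def)

lemma d3_InfWord_lessD:
  assumes "d3 (InfWord s) \<beta> < (1 / 2) ^ k"
  shows "prefix_of (stake k s) \<beta>"
proof (cases "\<beta> = InfWord s")
  case False
  then have "lcp_length (InfWord s) \<beta> > k"
    using assms power_decreasing[of "lcp_length (InfWord s) \<beta>" k "1 / 2 :: real"]
    by (force simp: d3_def not_less)
  then obtain w where w: "length w > k" "prefix_of w (InfWord s)" "prefix_of w \<beta>"
    using lcp_length_attained[of "InfWord s" \<beta>] False by metis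
  moreover have "prefix_of (stake k s) (InfWord s)" by simp
  ultimately have "prefix (stake k s) w"
    using prefix_of_comparable[of "stake k s" "InfWord s" w] by simp
  then show ?thesis using w prefix_of_trans by blast
qed simp

text \<open>The extra letter buys the strict inequality: agreement in \<open>Suc k\<close> letters
  means distance at most half of \<open>(1 / 2) ^ k\<close>.\<close>

lemma d3_InfWord_lessI:
  assumes "prefix_of (stake (Suc k) s) \<beta>"
  shows "d3 (InfWord s) \<beta> < (1 / 2) ^ k"
proof (cases "\<beta> = InfWord s")
  case False
  then have "Suc k \<le> lcp_length (InfWord s) \<beta>"
    using lcp_length_ge[of "InfWord s" \<beta> "stake (Suc k) s"] assms by auto
  then show ?thesis
    using False by (simp add: d3_def power_strict_decreasing)
qed (simp add: d3_def)

text \<open>No common prefix is longer than \<open>u\<close>, so every other word keeps this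
  distance. Finite words are thus isolated, and continuity on the completion only has to be examined
  at boundary points.\<close>

lemma d3_FinWord_isolated:
  assumes "d3 (FinWord u) \<beta> < (1 / 2) ^ length u"
  shows "\<beta> = FinWord u"
proof (rule ccontr)
  assume neq: "\<beta> \<noteq> FinWord u"
  then obtain w where "length w = lcp_length (FinWord u) \<beta>" "prefix_of w (FinWord u)"
    using lcp_length_attained[of "FinWord u" \<beta>] by auto
  then have "lcp_length (FinWord u) \<beta> \<le> length u"
    using prefix_length_le by force
  then have "(1 / 2 :: real) ^ length u \<le> (1 / 2) ^ lcp_length (FinWord u) \<beta>"
    by (intro power_decreasing) auto
  then show False using assms neq by (auto simp: d3_def)
qed

section \<open>Lengths and stability of normal forms\<close>

locale short_nf = group G for G :: "('g, 'm) monoid_scheme" (structure) +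
  fixes A :: "'a set"
    and \<pi> :: "('a \<times> bool) list \<Rightarrow> 'g"
    and N\<^sub>0 :: nat
    and R :: "(('a \<times> bool) \<times> ('a \<times> bool)) set"
  assumes finite_A: "finite A"
    and matched: "matched_epi G A \<pi>"
    and reduction: "bounded_reduction G A \<pi> N\<^sub>0"
    and order: "linear_order_on (letters A) R"
begin

abbreviation L :: "('a \<times> bool) list set" where "L \<equiv> nf_words G A \<pi> R"
abbreviation nfw :: "'g \<Rightarrow> ('a \<times> bool) list" where "nfw \<equiv> nf G A \<pi> R"
definition len :: "'g \<Rightarrow> nat" where "len x = length (nfw x)"
text \<open>The additional unit is spent when bounded reduction is applied backwards from
  \<open>x \<otimes> b\<close>, whose length may fall short of that of \<open>x\<close> by
  \<open>len b\<close>.\<close>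

definition N :: nat where "N = Suc N\<^sub>0"

lemma pi_Nil [simp]: "\<pi> [] = \<one>"
  and pi_append: "u \<in> words A \<Longrightarrow> v \<in> words A \<Longrightarrow> \<pi> (u @ v) = \<pi> u \<otimes> \<pi> v"
  and pi_inv: "a \<in> A \<Longrightarrow> \<pi> [(a, False)] = inv (\<pi> [(a, True)])"
  and pi_image: "\<pi> ` words A = carrier G"
  using matched by (auto simp: matched_epi_def)

lemma pi_closed [simp, intro]: "u \<in> words A \<Longrightarrow> \<pi> u \<in> carrier G"
  using pi_image by blast

lemma nfw_props: "x \<in> carrier G \<Longrightarrow> nfw x \<in> L \<and> \<pi> (nfw x) = x"
  unfolding nf_def
  by (rule theI'[OF nf_unique[OF finite_A order matched _ is_group]])

lemma nfw_in_L [simp]: "x \<in> carrier G \<Longrightarrow> nfw x \<in> L"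
  and pi_nfw [simp]: "x \<in> carrier G \<Longrightarrow> \<pi> (nfw x) = x"
  using nfw_props by auto

lemma L_words: "u \<in> L \<Longrightarrow> u \<in> words A"
  by (simp add: nf_words_def Geo_def)

lemma L_Geo: "u \<in> L \<Longrightarrow> u \<in> Geo G A \<pi>"
  by (simp add: nf_words_def)

lemma nfw_words [simp, intro]: "x \<in> carrier G \<Longrightarrow> nfw x \<in> words A"
  by (simp add: L_words)

lemma nfw_pi: "u \<in> L \<Longrightarrow> nfw (\<pi> u) = u"
  using nf_unique[OF finite_A order matched _ is_group, of "\<pi> u"] nfw_props[of "\<pi> u"] L_words
  by blast

lemma nfw_least: "u \<in> words A \<Longrightarrow> shortlex_le R (nfw (\<pi> u)) u"
  using nfw_props[of "\<pi> u"] by (simp add: nf_words_def)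

lemma shortlex_length: "shortlex_le r u v \<Longrightarrow> length u \<le> length v"
  by (auto simp: shortlex_le_def lenlex_conv)

lemma len_pi_le: "u \<in> words A \<Longrightarrow> len (\<pi> u) \<le> length u"
  unfolding len_def using nfw_least shortlex_length by blast

lemma len_pi_L: "u \<in> L \<Longrightarrow> len (\<pi> u) = length u"
  by (simp add: len_def nfw_pi)

lemma Geo_length: "u \<in> Geo G A \<pi> \<Longrightarrow> length u = len (\<pi> u)"
  using nfw_props[of "\<pi> u"] by (auto simp: Geo_def nf_words_def len_def)

lemma irrefl_R: "irrefl (R - Id)"
  by (simp add: irrefl_def)

lemma antisym_R: "antisym R"
  using order by (simp add: linear_order_on_def partial_order_on_def)

lemma finite_letters: "finite (letters A)"
  using finite_A by (simp add: letters_def)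

lemma lenlex_asym: "(u, v) \<in> lenlex (R - Id) \<Longrightarrow> (v, u) \<notin> lenlex (R - Id)"
proof -
  have R: "R \<subseteq> letters A \<times> letters A" "trans R"
    using order by (auto simp: linear_order_on_def partial_order_on_def preorder_on_def)
  have "finite R"
    using finite_subset[OF R(1)] finite_letters by simp
  moreover have "acyclic (R - Id)"
    using trancl_id[OF trans_diff_Id[OF R(2) antisym_R]] by (simp add: acyclic_def)
  ultimately have "wf (R - Id)"
    using finite_acyclic_wf finite_Diff by blast
  then show "(u, v) \<in> lenlex (R - Id) \<Longrightarrow> (v, u) \<notin> lenlex (R - Id)"
    by (meson wf_lenlex wf_asym)
qed

lemma shortlex_total:
  assumes "u \<in> words A" "v \<in> words A" "\<not> shortlex_le R u v"
  shows "(v, u) \<in> lenlex (R - Id)"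
proof -
  have tot: "total_on (letters A) R" using order by (simp add: linear_order_on_def)
  have "(u, v) \<in> lex (R - Id) \<or> u = v \<or> (v, u) \<in> lex (R - Id)"
    if "length u = length v" "u \<in> words A" "v \<in> words A" for u v
    using that tot by (induction u v rule: list_induct2) (auto simp: total_on_def)
  then show ?thesis using assms by (fastforce simp: lenlex_conv shortlex_le_def)
qed

text \<open>Membership in \<open>Geo\<close> is automatic: shortlex compares lengths first, so a
  least word for its element is geodesic.\<close>

lemma L_iff: "u \<in> L \<longleftrightarrow> u \<in> words A \<and> (\<forall>v\<in>words A. \<pi> v = \<pi> u \<longrightarrow> shortlex_le R u v)"
proof
  assume u: "u \<in> words A \<and> (\<forall>v\<in>words A. \<pi> v = \<pi> u \<longrightarrow> shortlex_le R u v)"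
  have "shortlex_le R u (nfw (\<pi> u))" "shortlex_le R (nfw (\<pi> u)) u"
    using u nfw_least by auto
  then have "u = nfw (\<pi> u)"
    using lenlex_asym by (auto simp: shortlex_le_def)
  then show "u \<in> L" using u nfw_in_L[of "\<pi> u"] by simp
next
  assume "u \<in> L"
  then show "u \<in> words A \<and> (\<forall>v\<in>words A. \<pi> v = \<pi> u \<longrightarrow> shortlex_le R u v)"
    unfolding nf_words_def Geo_def by blast
qed

text \<open>Shortlex is compatible with concatenation on both sides, so replacing a factor by a
  smaller word for the same element would make the whole word smaller.\<close>

lemma L_factor:
  assumes "p @ u @ q \<in> L"
  shows "u \<in> L"
proof -
  have w: "p \<in> words A" "u \<in> words A" "q \<in> words A"
    using L_words[OF assms] by simp_all
  have "shortlex_le R u v" if v: "v \<in> words A" "\<pi> v = \<pi> u" for v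
  proof (rule ccontr)
    assume "\<not> ?thesis"
    then have "(v, u) \<in> lenlex (R - Id)" using shortlex_total v w by blast
    then have *: "(p @ v @ q, p @ u @ q) \<in> lenlex (R - Id)"
      using lenlex_append1 lenlex_append2[OF irrefl_R] by blast
    have "shortlex_le R (p @ u @ q) (p @ v @ q)"
      using assms v w by (auto simp: L_iff pi_append)
    with * show False
      using lenlex_asym by (auto simp: shortlex_le_def)
  qed
  with w show ?thesis by (simp add: L_iff)
qed

lemma L_take: "u \<in> L \<Longrightarrow> take k u \<in> L"
  using L_factor[of "[]" "take k u" "drop k u"] by simp

lemma L_drop: "u \<in> L \<Longrightarrow> drop k u \<in> L"
  using L_factor[of "take k u" "drop k u" "[]"] by simp

section \<open>Inverses and the length function\<close>

lemma letter_closed [simp, intro]: "x \<in> letters A \<Longrightarrow> \<pi> [x] \<in> carrier G"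
  by (intro pi_closed) simp

lemma pi_linv: "x \<in> letters A \<Longrightarrow> \<pi> [linv x] = inv (\<pi> [x])"
  using pi_inv[of "fst x"] letter_closed[of "(fst x, True)"]
  by (cases x; cases "snd x") (auto simp: linv_def letters_def)

lemma linv_letters: "x \<in> letters A \<Longrightarrow> linv x \<in> letters A"
  by (auto simp: linv_def letters_def)

lemma pi_winv: "u \<in> words A \<Longrightarrow> winv u \<in> words A \<and> \<pi> (winv u) = inv (\<pi> u)"
proof (induction u)
  case (Cons x u)
  then have c: "winv (x # u) = winv u @ [linv x]" "winv u \<in> words A" "[linv x] \<in> words A"
    "x \<in> letters A" "u \<in> words A"
    by (auto simp: winv_def linv_letters)
  have "\<pi> (winv (x # u)) = inv (\<pi> u) \<otimes> inv (\<pi> [x])"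
    unfolding c(1) using pi_append[OF c(2,3)] Cons c by (simp add: pi_linv)
  also have "\<dots> = inv (\<pi> ([x] @ u))"
    using c pi_append[of "[x]" u] by (simp add: inv_mult_group)
  finally show ?case using c by simp
qed (simp add: winv_def)

lemma len_inv_le: "x \<in> carrier G \<Longrightarrow> len (inv x) \<le> len x"
  using pi_winv[of "nfw x"] len_pi_le[of "winv (nfw x)"] by (simp add: len_def winv_def)

lemma len_inv [simp]: "x \<in> carrier G \<Longrightarrow> len (inv x) = len x"
  using len_inv_le[of x] len_inv_le[of "inv x"] by simp

lemma len_mult: "x \<in> carrier G \<Longrightarrow> y \<in> carrier G \<Longrightarrow> len (x \<otimes> y) \<le> len x + len y"
  using len_pi_le[of "nfw x @ nfw y"] pi_append[of "nfw x" "nfw y"] by (simp add: len_def)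

lemma len_one [simp]: "len \<one> = 0"
  using len_pi_le[of "[]"] by simp

lemma nfw_one [simp]: "nfw \<one> = []"
  using len_one by (simp add: len_def)

lemma len_letter: "x \<in> letters A \<Longrightarrow> len (\<pi> [x]) \<le> 1"
  using len_pi_le[of "[x]"] by simp

lemma inv_mult_cancel: "x \<in> carrier G \<Longrightarrow> y \<in> carrier G \<Longrightarrow> inv x \<otimes> (x \<otimes> y) = y"
  by (simp flip: m_assoc)

lemma mult_inv_cancel: "x \<in> carrier G \<Longrightarrow> y \<in> carrier G \<Longrightarrow> x \<otimes> (inv x \<otimes> y) = y"
  by (simp flip: m_assoc)

lemma len_mult_ge: "x \<in> carrier G \<Longrightarrow> y \<in> carrier G \<Longrightarrow> len x \<le> len (x \<otimes> y) + len y"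
  using len_mult[of "x \<otimes> y" "inv y"] by (simp add: m_assoc)

lemma len_mult_ge': "x \<in> carrier G \<Longrightarrow> y \<in> carrier G \<Longrightarrow> len y \<le> len x + len (x \<otimes> y)"
  using len_mult[of "inv x" "x \<otimes> y"] by (simp add: inv_mult_cancel)

lemma len_inv_mult_commute:
  "x \<in> carrier G \<Longrightarrow> y \<in> carrier G \<Longrightarrow> len (inv x \<otimes> y) = len (inv y \<otimes> x)"
  using len_inv[of "inv x \<otimes> y"] by (simp add: inv_mult_group)

lemma inv_mult_telescope:
  "x \<in> carrier G \<Longrightarrow> y \<in> carrier G \<Longrightarrow> z \<in> carrier G \<Longrightarrow> (inv x \<otimes> y) \<otimes> (inv y \<otimes> z) = inv x \<otimes> z"
  by (simp add: m_assoc mult_inv_cancel)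

lemma len_triangle:
  "x \<in> carrier G \<Longrightarrow> y \<in> carrier G \<Longrightarrow> z \<in> carrier G \<Longrightarrow>
    len (inv x \<otimes> z) \<le> len (inv x \<otimes> y) + len (inv y \<otimes> z)"
  using len_mult[of "inv x \<otimes> y" "inv y \<otimes> z"] by (simp add: inv_mult_telescope)

lemma finite_len_ball: "finite {x \<in> carrier G. len x \<le> r}"
proof (rule finite_subset)
  show "{x \<in> carrier G. len x \<le> r} \<subseteq> \<pi> ` {u. set u \<subseteq> letters A \<and> length u \<le> r}"
  proof
    fix x assume "x \<in> {x \<in> carrier G. len x \<le> r}"
    then have "x = \<pi> (nfw x)" "nfw x \<in> words A" "length (nfw x) \<le> r"
      by (auto simp: len_def)
    then show "x \<in> \<pi> ` {u. set u \<subseteq> letters A \<and> length u \<le> r}"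
      by blast
  qed
  show "finite (\<pi> ` {u. set u \<subseteq> letters A \<and> length u \<le> r})"
    using finite_letters by (intro finite_imageI finite_lists_length_le)
qed

text \<open>Words of equal length are compared at their first difference, which lies among the first
  \<open>k\<close> letters once these prefixes differ.\<close>

lemma shortlex_take:
  assumes "shortlex_le R u v" "length u = length v" "take k u \<noteq> take k v"
  shows "(take k u, take k v) \<in> lenlex (R - Id)"
proof -
  have "(take k u @ drop k u, take k v @ drop k v) \<in> lex (R - Id)"
    using assms by (auto simp: shortlex_le_def lenlex_conv)
  then have "(take k u, take k v) \<in> lex (R - Id)"
    using lex_appendD assms by fastforce
  then show ?thesis using assms by (simp add: lenlex_conv)
qed

lemma geodesic_reduction:
  assumes "x \<in> carrier G" "b \<in> carrier G"
  obtains w where "w \<in> Geo G A \<pi>" "\<pi> w = x \<otimes> b"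
    "len x \<le> length (longest_common_prefix (nfw x) w) + N\<^sub>0 * len b"
proof -
  have "nfw x \<in> Geo G A \<pi>" "nfw b \<in> words A" "\<pi> (nfw x @ nfw b) = x \<otimes> b"
    using assms L_Geo pi_append[of "nfw x" "nfw b"] by auto
  with that reduction show thesis
    unfolding bounded_reduction_def len_def by metis
qed

text \<open>A first difference between the two normal forms would be ordered both ways: the geodesics
  supplied by bounded reduction in both directions carry it over to words representing the same
  element.\<close>

lemma nfw_stable:
  assumes x: "x \<in> carrier G" and b: "b \<in> carrier G" and k: "k + N * len b \<le> len x"
  shows "take k (nfw (x \<otimes> b)) = take k (nfw x)"
proof (rule ccontr)
  assume neq: "take k (nfw (x \<otimes> b)) \<noteq> take k (nfw x)"
  have xb: "x \<otimes> b \<in> carrier G" using x b by simp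
  obtain w where w: "w \<in> Geo G A \<pi>" "\<pi> w = x \<otimes> b"
    "len x \<le> length (longest_common_prefix (nfw x) w) + N\<^sub>0 * len b"
    using geodesic_reduction x b by blast
  obtain y where y: "y \<in> Geo G A \<pi>" "\<pi> y = x \<otimes> b \<otimes> inv b"
    "len (x \<otimes> b) \<le> length (longest_common_prefix (nfw (x \<otimes> b)) y) + N\<^sub>0 * len (inv b)"
    using geodesic_reduction xb inv_closed[OF b] by blast
  have yx: "\<pi> y = x" using y(2) x b by (simp add: m_assoc)
  have "k \<le> length (longest_common_prefix (nfw x) w)"
    using w(3) k by (simp add: N_def)
  then have tw: "take k w = take k (nfw x)"
    by (metis longest_common_prefix_prefix1 longest_common_prefix_prefix2 take_eq_of_common_prefix)
  have "len x \<le> len (x \<otimes> b) + len b"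
    using len_mult_ge x b by blast
  then have "k \<le> length (longest_common_prefix (nfw (x \<otimes> b)) y)"
    using y(3) k len_inv[OF b] by (simp add: N_def)
  then have ty: "take k y = take k (nfw (x \<otimes> b))"
    by (metis longest_common_prefix_prefix1 longest_common_prefix_prefix2 take_eq_of_common_prefix)
  have words: "w \<in> words A" "y \<in> words A" using w y by (auto simp: Geo_def)
  have "(take k (nfw x), take k y) \<in> lenlex (R - Id)"
    using nfw_least[OF words(2)] Geo_length[OF y(1)] yx neq ty
    by (intro shortlex_take) (auto simp: len_def)
  moreover have "(take k (nfw (x \<otimes> b)), take k w) \<in> lenlex (R - Id)"
    using nfw_least[OF words(1)] Geo_length[OF w(1)] w(2) neq tw
    by (intro shortlex_take) (auto simp: len_def)
  ultimately show False
    using tw ty lenlex_asym by auto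
qed

text \<open>A branch consists of the elements whose normal form starts with \<open>q\<close>. By
  \<open>nfw_stable\<close>, a step of length at most \<open>K\<close> from an element of length at
  least \<open>k + N * K\<close> keeps the first \<open>k\<close> letters, so the last element
  before leaving is short.\<close>

lemma leave_branch:
  assumes x: "\<And>i. x i \<in> carrier G" "\<And>i. len (inv (x i) \<otimes> x (Suc i)) \<le> K"
    and ab: "a \<le> b" "take k (nfw (x a)) = q" "take k (nfw (x b)) \<noteq> q"
  shows "\<exists>c. a \<le> c \<and> c \<le> b \<and> take k (nfw (x c)) = q \<and> len (x c) < k + N * K"
proof -
  obtain c where c: "a \<le> c" "c < b" "take k (nfw (x c)) = q" "take k (nfw (x (Suc c))) \<noteq> q"
    using switch_point[of a b "\<lambda>c. take k (nfw (x c)) = q"] ab by blast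
  have "\<not> k + N * len (inv (x c) \<otimes> x (Suc c)) \<le> len (x c)"
    using nfw_stable[of "x c" "inv (x c) \<otimes> x (Suc c)" k] c x(1) by (auto simp: mult_inv_cancel)
  moreover have "N * len (inv (x c) \<otimes> x (Suc c)) \<le> N * K"
    using x(2) by simp
  ultimately show ?thesis using c by (intro exI[of _ c]) linarith
qed

text \<open>The argument of \<open>leave_branch\<close> with the step reversed; here the short
  element is the first one inside the branch.\<close>

lemma enter_branch:
  assumes x: "\<And>i. x i \<in> carrier G" "\<And>i. len (inv (x i) \<otimes> x (Suc i)) \<le> K"
    and ab: "a \<le> b" "take k (nfw (x a)) \<noteq> q" "take k (nfw (x b)) = q"
  shows "\<exists>c. a \<le> c \<and> c \<le> b \<and> take k (nfw (x c)) = q \<and> len (x c) < k + N * K"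
proof -
  obtain c where c: "a \<le> c" "c < b" "take k (nfw (x c)) \<noteq> q" "take k (nfw (x (Suc c))) = q"
    using switch_point[of a b "\<lambda>c. take k (nfw (x c)) \<noteq> q"] ab by blast
  have "\<not> k + N * len (inv (x (Suc c)) \<otimes> x c) \<le> len (x (Suc c))"
    using nfw_stable[of "x (Suc c)" "inv (x (Suc c)) \<otimes> x c" k] c x(1)
    by (auto simp: mult_inv_cancel)
  moreover have "N * len (inv (x (Suc c)) \<otimes> x c) \<le> N * K"
    using x len_inv_mult_commute by (metis mult_le_mono2)
  ultimately show ?thesis using c by (intro exI[of _ "Suc c"]) linarith
qed

lemma pi_take_drop:
  assumes "x \<in> carrier G"
  shows "x = \<pi> (take k (nfw x)) \<otimes> \<pi> (drop k (nfw x))"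
  using pi_append[of "take k (nfw x)" "drop k (nfw x)"] assms L_words[OF L_take[OF nfw_in_L]]
    L_words[OF L_drop[OF nfw_in_L]] by simp

lemma pi_take_closed [simp, intro]: "x \<in> carrier G \<Longrightarrow> \<pi> (take k (nfw x)) \<in> carrier G"
  and pi_drop_closed [simp, intro]: "x \<in> carrier G \<Longrightarrow> \<pi> (drop k (nfw x)) \<in> carrier G"
  using L_words[OF L_take[OF nfw_in_L]] L_words[OF L_drop[OF nfw_in_L]] by auto

lemma inv_pi_take_mult:
  "x \<in> carrier G \<Longrightarrow> inv (\<pi> (take k (nfw x))) \<otimes> x = \<pi> (drop k (nfw x))"
  using pi_take_drop[of x k] inv_mult_cancel[OF pi_take_closed[of x k] pi_drop_closed[of x k]]
  by metis

text \<open>What remains after removing a prefix is spelt by a suffix of a normal form, which is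
  itself a normal form.\<close>

lemma len_inv_pi_take:
  assumes "x \<in> carrier G"
  shows "len (inv (\<pi> (take k (nfw x))) \<otimes> x) = len x - k"
  using len_pi_L[OF L_drop[OF nfw_in_L[OF assms]], of k] inv_pi_take_mult[OF assms]
  by (simp add: len_def)

text \<open>Travel from \<open>x\<close> to \<open>y\<close> through the element spelt by the common
  prefix.\<close>

lemma len_same_branch:
  assumes "x \<in> carrier G" "y \<in> carrier G" "take k (nfw x) = take k (nfw y)"
  shows "len (inv x \<otimes> y) \<le> (len x - k) + (len y - k)"
  using len_triangle[of x "\<pi> (take k (nfw x))" y] assms
    len_inv_pi_take[of x k] len_inv_pi_take[of y k] len_inv_mult_commute[of x "\<pi> (take k (nfw x))"]
  by simp

text \<open>Extend the prefix of \<open>x\<close> letter by letter from length \<open>n\<close> to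
  all of \<open>x\<close>. Each partial product has length at least \<open>k + N\<close>, since
  \<open>g\<close> cancels at most \<open>len g\<close> letters; hence by \<open>nfw_stable\<close>
  one more letter leaves the first \<open>k\<close> letters alone.\<close>

lemma left_mult_stable:
  assumes g: "g \<in> carrier G" and x: "x \<in> carrier G" and n: "k + N + len g \<le> n"
  shows "take k (nfw (g \<otimes> x)) = take k (nfw (g \<otimes> \<pi> (take n (nfw x))))"
proof -
  define u where "u = nfw x"
  have u: "u \<in> L" using x by (simp add: u_def)
  have *: "take k (nfw (g \<otimes> \<pi> (take (n + i) u))) = take k (nfw (g \<otimes> \<pi> (take n u)))" for i
  proof (induction i)
    case (Suc i)
    show ?case
    proof (cases "n + i < length u")
      case True
      define y where "y = \<pi> (take (n + i) u)"
      define b where "b = \<pi> [u ! (n + i)]"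
      have l: "u ! (n + i) \<in> letters A"
        using L_words[OF u] True by (simp add: in_lists_conv_set)
      have t: "take (n + i) u \<in> L" using u L_take by blast
      have y: "y \<in> carrier G" "b \<in> carrier G"
        using l L_words[OF t] by (auto simp: y_def b_def)
      have "n + i = len y"
        using len_pi_L[OF t] True by (simp add: y_def)
      then have "k + N * 1 \<le> len (g \<otimes> y)"
        using len_mult_ge'[OF g y(1)] n by linarith
      moreover have "len b \<le> 1" using len_letter[OF l] by (simp add: b_def)
      ultimately have "k + N * len b \<le> len (g \<otimes> y)"
        by (metis add_left_mono mult_le_mono2 order_trans)
      then have "take k (nfw (g \<otimes> y \<otimes> b)) = take k (nfw (g \<otimes> y))"
        using g y by (intro nfw_stable) auto
      moreover have "\<pi> (take (n + Suc i) u) = y \<otimes> b"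
        using True pi_append[OF L_words[OF t], of "[u ! (n + i)]"] l
        by (simp add: take_Suc_conv_app_nth y_def b_def)
      ultimately show ?thesis
        using Suc.IH g y by (simp add: m_assoc y_def)
    qed (use Suc.IH in simp)
  qed simp
  from *[of "length u"] show ?thesis
    using x by (simp add: u_def)
qed

section \<open>Boundary points and the action on them\<close>

definition is_ray :: "('a \<times> bool) stream \<Rightarrow> bool"
  where "is_ray s \<longleftrightarrow> (\<forall>n. stake n s \<in> L)"

definition ray :: "('a \<times> bool) stream \<Rightarrow> nat \<Rightarrow> 'g"
  where "ray s n = \<pi> (stake n s)"

text \<open>For a ray \<open>s\<close> this is convergence to \<open>s\<close> in the completion
  (\<open>limitin_iff_tends\<close>), in a form that needs only prefixes.\<close>

definition tends :: "(nat \<Rightarrow> 'g) \<Rightarrow> ('a \<times> bool) stream \<Rightarrow> bool"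
  where "tends x s \<longleftrightarrow> (\<forall>k. \<forall>\<^sub>F n in sequentially. take k (nfw (x n)) = stake k s)"

lemma ray_closed [simp, intro]: "is_ray s \<Longrightarrow> ray s n \<in> carrier G"
  by (simp add: ray_def is_ray_def L_words pi_closed)

lemma nfw_ray: "is_ray s \<Longrightarrow> nfw (ray s n) = stake n s"
  by (simp add: ray_def is_ray_def nfw_pi)

lemma len_ray: "is_ray s \<Longrightarrow> len (ray s n) = n"
  by (simp add: len_def nfw_ray)

lemma ray_0 [simp]: "ray s 0 = \<one>"
  by (simp add: ray_def)

lemma is_ray_sdrop: "is_ray s \<Longrightarrow> is_ray (sdrop l s)"
  unfolding is_ray_def by (metis L_drop drop_stake diff_add_inverse)

lemma ray_add: "is_ray s \<Longrightarrow> ray s (m + n) = ray s m \<otimes> ray (sdrop m s) n"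
  using is_ray_sdrop[of s m] L_words pi_append[of "stake m s" "stake n (sdrop m s)"]
  unfolding ray_def is_ray_def by (metis stake_add)

lemma inv_ray_mult: "is_ray s \<Longrightarrow> inv (ray s m) \<otimes> ray s (m + n) = ray (sdrop m s) n"
  by (simp add: ray_add inv_mult_cancel is_ray_sdrop)

text \<open>The piece of a ray between two of its vertices is again a normal form, so rays are
  geodesic. Integers allow both orders of \<open>m\<close> and \<open>n\<close> at once.\<close>

lemma len_inv_ray_mult:
  assumes "is_ray s"
  shows "int (len (inv (ray s m) \<otimes> ray s n)) = \<bar>int n - int m\<bar>"
proof (cases "m \<le> n")
  case True
  then show ?thesis
    using inv_ray_mult[OF assms, of m "n - m"] len_ray[OF is_ray_sdrop[OF assms]] by simp
next
  case False
  then show ?thesis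
    using inv_ray_mult[OF assms, of n "m - n"] len_ray[OF is_ray_sdrop[OF assms]] assms
      len_inv_mult_commute[of "ray s m" "ray s n"] by simp
qed

lemma ray_Suc: "is_ray s \<Longrightarrow> ray s (Suc n) = ray s n \<otimes> \<pi> [s !! n]"
  and ray_letter: "is_ray s \<Longrightarrow> s !! n \<in> letters A"
proof -
  assume s: "is_ray s"
  then have w: "stake n s @ [s !! n] \<in> words A" "stake n s \<in> words A"
    using L_words unfolding is_ray_def by (metis stake_Suc, blast)
  then show "s !! n \<in> letters A" by simp
  then show "ray s (Suc n) = ray s n \<otimes> \<pi> [s !! n]"
    using w pi_append[of "stake n s" "[s !! n]"]
    by (simp add: ray_def stake_Suc del: stake.simps)
qed

lemma tends_ray: "is_ray s \<Longrightarrow> tends (ray s) s"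
  unfolding tends_def eventually_sequentially by (auto simp: nfw_ray take_stake min_def)

lemma tends_unique:
  assumes "tends x s" "tends x t"
  shows "s = t"
proof -
  have "stake k s = stake k t" for k
  proof -
    have "\<forall>\<^sub>F n in sequentially. take k (nfw (x n)) = stake k s \<and> take k (nfw (x n)) = stake k t"
      using assms by (simp add: tends_def eventually_conj)
    then show ?thesis
      by (metis (mono_tags, lifting) eventually_happens trivial_limit_sequentially)
  qed
  then show ?thesis by (simp add: stream_eq_iff_stake)
qed

lemma tends_offset: "tends (\<lambda>n. x (l + n)) s \<longleftrightarrow> tends x s"
  unfolding tends_def
  using eventually_sequentially_seg[where k = l and P = "\<lambda>n. take k (nfw (x n)) = stake k s" for k]
  by (simp add: add.commute)

text \<open>By \<open>left_mult_stable\<close>, the first \<open>k\<close> letters of \<open>g x\<close> are determined by the first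
  \<open>k + N + len g\<close> letters of \<open>x\<close>.\<close>

definition lim_mult :: "'g \<Rightarrow> ('a \<times> bool) stream \<Rightarrow> ('a \<times> bool) stream"
  where "lim_mult g s = smap (\<lambda>i. nfw (g \<otimes> ray s (Suc i + N + len g)) ! i) nats"

lemma lim_mult_stake:
  assumes g: "g \<in> carrier G" and s: "is_ray s" and n: "k + N + len g \<le> n"
  shows "stake k (lim_mult g s) = take k (nfw (g \<otimes> ray s n))"
proof (rule nth_equalityI)
  have "n \<le> len g + len (g \<otimes> ray s n)"
    using len_mult_ge'[OF g, of "ray s n"] s by (simp add: len_ray)
  then have l: "k \<le> length (nfw (g \<otimes> ray s n))"
    using n by (simp add: len_def[symmetric])
  then show "length (stake k (lim_mult g s)) = length (take k (nfw (g \<otimes> ray s n)))"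
    by simp
  fix i assume "i < length (stake k (lim_mult g s))"
  then have i: "i < k" by simp
  have "take (Suc i) (nfw (g \<otimes> ray s n)) =
      take (Suc i) (nfw (g \<otimes> \<pi> (take (Suc i + N + len g) (nfw (ray s n)))))"
    using g s n i by (intro left_mult_stable) auto
  also have "\<pi> (take (Suc i + N + len g) (nfw (ray s n))) = ray s (Suc i + N + len g)"
    using s n i by (simp only: nfw_ray take_stake) (simp add: ray_def min_def del: stake.simps)
  finally have "nfw (g \<otimes> ray s n) ! i = nfw (g \<otimes> ray s (Suc i + N + len g)) ! i"
    by (metis lessI nth_take)
  then show "stake k (lim_mult g s) ! i = take k (nfw (g \<otimes> ray s n)) ! i"
    using i l by (simp add: lim_mult_def)
qed

lemma lim_mult_take:
  assumes "g \<in> carrier G" "is_ray s" "x \<in> carrier G"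
    and "take (k + N + len g) (nfw x) = stake (k + N + len g) s"
  shows "take k (nfw (g \<otimes> x)) = stake k (lim_mult g s)"
  using left_mult_stable[OF assms(1,3) order_refl, of k] lim_mult_stake[OF assms(1,2) order_refl, of k] assms(4)
  by (simp add: ray_def)

lemma is_ray_lim_mult: "g \<in> carrier G \<Longrightarrow> is_ray s \<Longrightarrow> is_ray (lim_mult g s)"
  unfolding is_ray_def[of "lim_mult g s"] by (simp add: lim_mult_stake[OF _ _ order_refl] L_take)

lemma tends_mult:
  assumes "g \<in> carrier G" "is_ray s" "\<And>n. x n \<in> carrier G" "tends x s"
  shows "tends (\<lambda>n. g \<otimes> x n) (lim_mult g s)"
  unfolding tends_def
proof
  fix k
  have "\<forall>\<^sub>F n in sequentially. take (k + N + len g) (nfw (x n)) = stake (k + N + len g) s"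
    using assms(4) by (simp add: tends_def)
  then show "\<forall>\<^sub>F n in sequentially. take k (nfw (g \<otimes> x n)) = stake k (lim_mult g s)"
    by eventually_elim (use assms lim_mult_take in blast)
qed

lemma lim_mult_inv_ray:
  assumes "is_ray s"
  shows "lim_mult (inv (ray s l)) s = sdrop l s"
proof (rule tends_unique)
  show "tends (\<lambda>n. inv (ray s l) \<otimes> ray s (l + n)) (lim_mult (inv (ray s l)) s)"
    using assms by (intro tends_mult) (auto simp: tends_offset tends_ray)
  show "tends (\<lambda>n. inv (ray s l) \<otimes> ray s (l + n)) (sdrop l s)"
    using assms by (simp add: inv_ray_mult tends_ray is_ray_sdrop)
qed

lemma lim_mult_mult:
  assumes "g \<in> carrier G" "h \<in> carrier G" "is_ray s"
  shows "lim_mult g (lim_mult h s) = lim_mult (g \<otimes> h) s"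
proof (rule tends_unique)
  show "tends (\<lambda>n. g \<otimes> (h \<otimes> ray s n)) (lim_mult g (lim_mult h s))"
    using assms by (intro tends_mult tends_ray is_ray_lim_mult) auto
  have "tends (\<lambda>n. (g \<otimes> h) \<otimes> ray s n) (lim_mult (g \<otimes> h) s)"
    using assms by (intro tends_mult tends_ray) auto
  then show "tends (\<lambda>n. g \<otimes> (h \<otimes> ray s n)) (lim_mult (g \<otimes> h) s)"
    using assms by (simp add: m_assoc)
qed

section \<open>Topology of the completion\<close>

lemma boundary_iff: "\<alpha> \<in> boundary G A \<pi> R \<longleftrightarrow> (\<exists>s. \<alpha> = InfWord s \<and> is_ray s)"
  by (auto simp: boundary_def is_ray_def)

sublocale completion: Metric_space "Lhat G A \<pi> R" d3
  by (rule Metric_space_d3)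

lemma Lhat_iff:
  "\<alpha> \<in> Lhat G A \<pi> R \<longleftrightarrow> (\<exists>u\<in>L. \<alpha> = FinWord u) \<or> (\<exists>s. \<alpha> = InfWord s \<and> is_ray s)"
  by (auto simp: Lhat_def boundary_iff)

lemma limitin_iff_tends:
  assumes "is_ray s" "\<And>n. x n \<in> carrier G"
  shows "limitin (Lhat_topology G A \<pi> R) (\<lambda>n. FinWord (nfw (x n))) (InfWord s) sequentially
    \<longleftrightarrow> tends x s"
proof
  assume lim: "limitin (Lhat_topology G A \<pi> R) (\<lambda>n. FinWord (nfw (x n))) (InfWord s) sequentially"
  show "tends x s"
    unfolding tends_def
  proof
    fix k
    have "\<forall>\<^sub>F n in sequentially. FinWord (nfw (x n)) \<in> Lhat G A \<pi> R \<and>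
        d3 (FinWord (nfw (x n))) (InfWord s) < (1 / 2) ^ k"
      using lim unfolding Lhat_topology_def completion.limitin_metric by simp
    then show "\<forall>\<^sub>F n in sequentially. take k (nfw (x n)) = stake k s"
      by eventually_elim
        (metis completion.commute d3_InfWord_lessD prefix_of_stake_FinWord)
  qed
next
  assume t: "tends x s"
  show "limitin (Lhat_topology G A \<pi> R) (\<lambda>n. FinWord (nfw (x n))) (InfWord s) sequentially"
    unfolding Lhat_topology_def completion.limitin_metric
  proof (intro conjI allI impI)
    show "InfWord s \<in> Lhat G A \<pi> R" using assms by (auto simp: Lhat_iff)
    fix e :: real assume "e > 0"
    then obtain k where k: "(1 / 2) ^ k < e"
      using real_arch_pow_inv[of e "1 / 2"] by auto
    have "\<forall>\<^sub>F n in sequentially. take (Suc k) (nfw (x n)) = stake (Suc k) s"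
      using t unfolding tends_def by blast
    then show "\<forall>\<^sub>F n in sequentially. FinWord (nfw (x n)) \<in> Lhat G A \<pi> R \<and>
        d3 (FinWord (nfw (x n))) (InfWord s) < e"
    proof eventually_elim
      case (elim n)
      then have "d3 (InfWord s) (FinWord (nfw (x n))) < (1 / 2) ^ k"
        by (intro d3_InfWord_lessI) (simp only: prefix_of_stake_FinWord)
      with k assms show ?case by (auto simp: Lhat_iff completion.commute)
    qed
  qed
qed

text \<open>Continuity evaluates an extension at a boundary point as a limit along its ray;
  \<open>f\<close> is the map \<open>h\<close> of the group read on normal forms. This serves the
  action and \<Phi> alike.\<close>

lemma limitin_continuous_extension:
  assumes ext: "continuous_extension G A \<pi> R f F" and s: "is_ray s"
    and f: "\<And>x. x \<in> carrier G \<Longrightarrow> f (nfw x) = nfw (h x)"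
  shows "limitin (Lhat_topology G A \<pi> R) (\<lambda>n. FinWord (nfw (h (ray s n)))) (F (InfWord s)) sequentially"
proof -
  have "limitin (Lhat_topology G A \<pi> R) (\<lambda>n. FinWord (nfw (ray s n))) (InfWord s) sequentially"
    by (rule iffD2[OF limitin_iff_tends[OF s ray_closed[OF s]] tends_ray[OF s]])
  then have "limitin (Lhat_topology G A \<pi> R) (F \<circ> (\<lambda>n. FinWord (nfw (ray s n)))) (F (InfWord s)) sequentially"
    by (rule continuous_map_limit[OF ext[unfolded continuous_extension_def, THEN conjunct1]])
  moreover have "F \<circ> (\<lambda>n. FinWord (nfw (ray s n))) = (\<lambda>n. FinWord (nfw (h (ray s n))))"
  proof
    fix n
    have "F (FinWord (nfw (ray s n))) = FinWord (f (nfw (ray s n)))"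
      using ext nfw_in_L[OF ray_closed[OF s], of n] unfolding continuous_extension_def by blast
    then show "(F \<circ> (\<lambda>n. FinWord (nfw (ray s n)))) n = FinWord (nfw (h (ray s n)))"
      using f s by simp
  qed
  ultimately show ?thesis by simp
qed

text \<open>An explicit continuous extension of left multiplication; it shows that the choice made
  in \<open>act\<close> has a witness.\<close>

definition mult_ext :: "'g \<Rightarrow> ('a \<times> bool) fiword \<Rightarrow> ('a \<times> bool) fiword"
  where "mult_ext g \<alpha> =
    (case \<alpha> of FinWord u \<Rightarrow> FinWord (nfw (g \<otimes> \<pi> u)) | InfWord s \<Rightarrow> InfWord (lim_mult g s))"

lemma mult_ext_prefix:
  assumes "g \<in> carrier G" "is_ray s" "\<beta> \<in> Lhat G A \<pi> R"
    and p: "prefix_of (stake (k + N + len g) s) \<beta>"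
  shows "prefix_of (stake k (lim_mult g s)) (mult_ext g \<beta>)"
proof (cases \<beta>)
  case (FinWord u)
  then have "u \<in> L" using assms by (auto simp: Lhat_iff)
  then have "\<pi> u \<in> carrier G" "nfw (\<pi> u) = u" by (auto simp: L_words nfw_pi)
  then show ?thesis
    using lim_mult_take[OF assms(1,2), of "\<pi> u" k] p FinWord
    by (simp add: prefix_of_stake_FinWord mult_ext_def del: prefix_of.simps)
next
  case (InfWord t)
  then have t: "is_ray t" using assms by (auto simp: Lhat_iff)
  have "ray t (k + N + len g) = ray s (k + N + len g)"
    using p InfWord by (simp add: ray_def)
  then have "stake k (lim_mult g s) = stake k (lim_mult g t)"
    using lim_mult_stake[OF assms(1,2) order_refl, of k] lim_mult_stake[OF assms(1) t order_refl, of k]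
    by simp
  then show ?thesis
    using InfWord by (simp add: mult_ext_def)
qed

lemma continuous_extension_mult_ext:
  assumes g: "g \<in> carrier G"
  shows "continuous_extension G A \<pi> R (\<lambda>v. nfw (\<pi> (nfw g @ v))) (mult_ext g)"
  unfolding continuous_extension_def Lhat_topology_def
proof
  show "\<forall>u\<in>L. mult_ext g (FinWord u) = FinWord (nfw (\<pi> (nfw g @ u)))"
    using g by (auto simp: mult_ext_def pi_append L_words)
  show "continuous_map completion.mtopology completion.mtopology (mult_ext g)"
    unfolding completion.metric_continuous_map[OF Metric_space_d3]
  proof (intro conjI ballI allI impI)
    show "mult_ext g ` Lhat G A \<pi> R \<subseteq> Lhat G A \<pi> R"
      using g is_ray_lim_mult by (auto simp: Lhat_iff mult_ext_def L_words)
  next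
    fix \<alpha> and e :: real
    assume \<alpha>: "\<alpha> \<in> Lhat G A \<pi> R" and e: "e > 0"
    show "\<exists>\<delta>>0. \<forall>x. x \<in> Lhat G A \<pi> R \<and> d3 \<alpha> x < \<delta> \<longrightarrow> d3 (mult_ext g \<alpha>) (mult_ext g x) < e"
    proof (cases \<alpha>)
      case (FinWord u)
      then have "d3 (mult_ext g \<alpha>) (mult_ext g x) < e" if "d3 \<alpha> x < (1 / 2) ^ length u" for x
        using d3_FinWord_isolated[of u x] that e by simp
      then show ?thesis
        by (intro exI[of _ "(1 / 2) ^ length u"]) auto
    next
      case (InfWord s)
      obtain k where k: "(1 / 2) ^ k < e"
        using real_arch_pow_inv[of e "1 / 2"] e by auto
      \<comment> \<open>\<open>Suc k\<close> letters of the image put it within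
        \<open>(1 / 2) ^ k\<close>; they are determined by \<open>N + len g\<close> more letters of
        the argument.\<close>
      have "d3 (mult_ext g \<alpha>) (mult_ext g x) < e"
        if "x \<in> Lhat G A \<pi> R" "d3 \<alpha> x < (1 / 2) ^ (Suc k + N + len g)" for x
      proof -
        have "is_ray s" using \<alpha> InfWord by (auto simp: Lhat_iff)
        moreover have "prefix_of (stake (Suc k + N + len g) s) x"
          using that(2) InfWord by (intro d3_InfWord_lessD) (simp only:)
        ultimately have "prefix_of (stake (Suc k) (lim_mult g s)) (mult_ext g x)"
          using mult_ext_prefix[OF g _ that(1)] by blast
        then have "d3 (InfWord (lim_mult g s)) (mult_ext g x) < (1 / 2) ^ k"
          by (rule d3_InfWord_lessI)
        moreover have "mult_ext g \<alpha> = InfWord (lim_mult g s)"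
          using InfWord by (simp add: mult_ext_def)
        ultimately show ?thesis using k by simp
      qed
      moreover have "(1 / 2 :: real) ^ (Suc k + N + len g) > 0" by (rule zero_less_power) simp
      ultimately show ?thesis by blast
    qed
  qed
qed

text \<open>Any continuous extension takes at \<open>s\<close> the limit along the ray, and limits
  in a metric space are unique, so the choice in \<open>act\<close> does not matter here.\<close>

lemma act_InfWord:
  assumes g: "g \<in> carrier G" and s: "is_ray s"
  shows "act G A \<pi> R g (InfWord s) = InfWord (lim_mult g s)"
proof -
  have ext: "continuous_extension G A \<pi> R (\<lambda>v. nfw (\<pi> (nfw g @ v))) (act G A \<pi> R g)"
    unfolding act_def
    by (rule someI[of "continuous_extension G A \<pi> R (\<lambda>v. nfw (\<pi> (nfw g @ v)))"])
      (rule continuous_extension_mult_ext[OF g])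
  have 1: "limitin (Lhat_topology G A \<pi> R) (\<lambda>n. FinWord (nfw (g \<otimes> ray s n)))
      (act G A \<pi> R g (InfWord s)) sequentially"
    using g by (intro limitin_continuous_extension[OF ext s]) (simp add: pi_append)
  have 2: "limitin (Lhat_topology G A \<pi> R) (\<lambda>n. FinWord (nfw (g \<otimes> ray s n)))
      (InfWord (lim_mult g s)) sequentially"
    using g s
    by (intro iffD2[OF limitin_iff_tends[OF is_ray_lim_mult]] tends_mult tends_ray) simp_all
  show ?thesis
    using completion.limitin_metric_unique[OF 1[unfolded Lhat_topology_def] 2[unfolded Lhat_topology_def]]
    by simp
qed

section \<open>Fixed boundary points\<close>

lemma d1_eq_len:
  assumes "x \<in> carrier G" "y \<in> carrier G"
  shows "d1 G A \<pi> x y = len (inv x \<otimes> y)"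
  unfolding d1_def
proof (rule Least_equality)
  show "\<exists>u\<in>words A. length u = len (inv x \<otimes> y) \<and> x \<otimes> \<pi> u = y"
    using assms by (intro bexI[of _ "nfw (inv x \<otimes> y)"]) (auto simp: len_def mult_inv_cancel)
next
  fix n assume "\<exists>u\<in>words A. length u = n \<and> x \<otimes> \<pi> u = y"
  then obtain u where u: "u \<in> words A" "length u = n" "x \<otimes> \<pi> u = y" by blast
  then have "\<pi> u = inv x \<otimes> y" using assms inv_mult_cancel[of x "\<pi> u"] by auto
  then show "len (inv x \<otimes> y) \<le> n" using len_pi_le u by metis
qed

lemma rho_nonneg: "rho G A \<pi> \<epsilon> x y \<ge> 0"
  by (simp add: rho_def)

lemma chain_sum_rho_nonneg: "chain_sum (rho G A \<pi> \<epsilon>) xs \<ge> 0"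
  unfolding chain_sum_def by (intro sum_nonneg rho_nonneg)

lemma d2_le_rho: "d2 G A \<pi> \<epsilon> x y \<le> rho G A \<pi> \<epsilon> x y"
proof -
  have "chain_sum (rho G A \<pi> \<epsilon>) (x # [] @ [y]) = rho G A \<pi> \<epsilon> x y"
    by (simp add: chain_sum_def)
  then have "rho G A \<pi> \<epsilon> x y \<in>
      {chain_sum (rho G A \<pi> \<epsilon>) (x # gs @ [y]) | gs. gs \<in> lists (carrier G)}"
    by (smt (verit) lists.Nil mem_Collect_eq)
  then show ?thesis
    unfolding d2_def by (rule cInf_lower) (auto intro!: bdd_belowI[of _ 0] chain_sum_rho_nonneg)
qed

text \<open>A chain starting at the identity must leave it at some step, which costs \<open>z^0 = 1\<close>.\<close>

lemma d2_one_ge: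
  assumes "x \<noteq> \<one>"
  shows "d2 G A \<pi> \<epsilon> \<one> x \<ge> 1"
  unfolding d2_def
proof (rule cInf_greatest)
  show "{chain_sum (rho G A \<pi> \<epsilon>) (\<one> # gs @ [x]) | gs. gs \<in> lists (carrier G)} \<noteq> {}"
    by blast
  fix c assume "c \<in> {chain_sum (rho G A \<pi> \<epsilon>) (\<one> # gs @ [x]) | gs. gs \<in> lists (carrier G)}"
  then obtain gs where c: "c = chain_sum (rho G A \<pi> \<epsilon>) (\<one> # gs @ [x])" by blast
  define xs where "xs = \<one> # gs @ [x]"
  have "xs ! 0 = \<one>" "xs ! (length xs - 1) \<noteq> \<one>"
    using assms by (auto simp: xs_def nth_append)
  then obtain i where i: "i < length xs - 1" "xs ! i = \<one>" "xs ! Suc i \<noteq> \<one>"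
    using switch_point[of 0 "length xs - 1" "\<lambda>i. xs ! i = \<one>"] by blast
  have "rho G A \<pi> \<epsilon> (xs ! i) (xs ! Suc i) = 1"
    using i d1_eq_len[of \<one> \<one>] by (simp add: rho_def gromov_product_def)
  moreover have "rho G A \<pi> \<epsilon> (xs ! i) (xs ! Suc i) \<le> (\<Sum>i<length xs - 1. rho G A \<pi> \<epsilon> (xs ! i) (xs ! Suc i))"
    using i by (intro member_le_sum) (auto intro: rho_nonneg)
  ultimately show "c \<ge> 1" by (simp add: c xs_def chain_sum_def)
qed

text \<open>The Gromov product of \<open>k\<close> and \<open>k \<otimes> g\<close> is at least
  \<open>len k - len g\<close>, so \<open>rho\<close> decays exponentially in the length of
  \<open>k\<close>.\<close>

lemma d2_mult_small:
  assumes "g \<in> carrier G" "\<epsilon> > 0" "\<eta> > 0"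
  shows "\<exists>C. \<forall>k\<in>carrier G. len k > C \<longrightarrow> d2 G A \<pi> \<epsilon> k (k \<otimes> g) < \<eta>"
proof -
  \<comment> \<open>Chosen such that \<open>exp (- \<epsilon> * C0) < \<eta>\<close>.\<close>
  obtain C0 :: nat where C0: "real C0 > - ln \<eta> / \<epsilon>" using reals_Archimedean2 by blast
  have "d2 G A \<pi> \<epsilon> k (k \<otimes> g) < \<eta>" if k: "k \<in> carrier G" "len k > C0 + len g" for k
  proof (cases "k = k \<otimes> g")
    case True
    then show ?thesis using d2_le_rho[of \<epsilon> k "k \<otimes> g"] assms by (simp add: rho_def)
  next
    case False
    have "gromov_product G A \<pi> k (k \<otimes> g) = (real (len k) + real (len (k \<otimes> g)) - real (len g)) / 2"
      using k assms by (simp add: gromov_product_def d1_eq_len inv_mult_cancel)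
    moreover have "real (len k) \<le> real (len (k \<otimes> g)) + real (len g)"
      using len_mult_ge[OF k(1) assms(1)] by linarith
    moreover have "real (len k) > real C0 + real (len g)"
      using k(2) by linarith
    ultimately have "gromov_product G A \<pi> k (k \<otimes> g) > C0"
      by (simp add: field_simps)
    then have "\<epsilon> * gromov_product G A \<pi> k (k \<otimes> g) > - ln \<eta>"
      using C0 assms(2) by (smt (verit) mult.commute pos_divide_less_eq)
    then have "exp (- (\<epsilon> * gromov_product G A \<pi> k (k \<otimes> g))) < exp (ln \<eta>)"
      by simp
    then have "rho G A \<pi> \<epsilon> k (k \<otimes> g) < \<eta>"
      using False assms by (simp add: rho_def powr_def mult.commute)
    then show ?thesis using d2_le_rho[of \<epsilon> k "k \<otimes> g"] by linarith
  qed
  then show ?thesis by blast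
qed

lemma lim_mult_one: "is_ray s \<Longrightarrow> lim_mult \<one> s = s"
  using tends_mult[of \<one> s "ray s"] tends_unique[of "ray s" "lim_mult \<one> s" s] tends_ray[of s]
  by (simp add: tends_ray)

end

section \<open>Properness of uniformly continuous endomorphisms\<close>

locale short_nf_endo = short_nf G A \<pi> N\<^sub>0 R
  for G :: "('g, 'm) monoid_scheme" (structure)
    and A :: "'a set" and \<pi> N\<^sub>0 R +
  fixes \<phi> :: "'g \<Rightarrow> 'g"
  assumes phi_hom: "\<phi> \<in> hom G G"
begin

sublocale phi: group_hom G G \<phi>
  using phi_hom by (simp add: group_hom_def group_hom_axioms_def is_group)

text \<open>If infinitely many elements have images in one ball, then the kernel is infinite. For
  \<open>k\<close> in the kernel with \<open>len k\<close> large, \<open>k\<close> and \<open>k g\<close> are close, hence so are \<open>\<one>\<close> and \<open>\<phi> g\<close>,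
  although \<open>\<one>\<close> is isolated.\<close>

lemma unif_continuous_proper:
  assumes \<epsilon>: "\<epsilon> > 0"
    and uc: "unif_continuous (carrier G) (d2 G A \<pi> \<epsilon>) \<phi>"
    and nontriv: "g \<in> carrier G" "\<phi> g \<noteq> \<one>"
  shows "\<exists>C. \<forall>x\<in>carrier G. len (\<phi> x) \<le> r \<longrightarrow> len x \<le> C"
proof (rule ccontr)
  assume "\<not> ?thesis"
  then have unb: "\<exists>x\<in>carrier G. len (\<phi> x) \<le> r \<and> len x > C" for C by (auto simp: not_le)
  define S where "S = {x \<in> carrier G. len (\<phi> x) \<le> r}"
  have "infinite S"
  proof
    assume "finite S"
    moreover obtain x where "x \<in> S" "len x > Max (len ` S)"
      using unb[of "Max (len ` S)"] by (auto simp: S_def)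
    ultimately show False by (meson Max_ge finite_imageI image_eqI not_less)
  qed
  moreover have "finite (\<phi> ` S)"
    by (rule finite_subset[OF _ finite_len_ball[of r]]) (auto simp: S_def)
  ultimately obtain a where a: "a \<in> S" "infinite {x \<in> S. \<phi> x = \<phi> a}"
    using pigeonhole_infinite[of S \<phi>] by blast
  obtain \<eta> where \<eta>: "\<eta> > 0" and close:
    "\<And>x y. x \<in> carrier G \<Longrightarrow> y \<in> carrier G \<Longrightarrow> d2 G A \<pi> \<epsilon> x y < \<eta> \<Longrightarrow> d2 G A \<pi> \<epsilon> (\<phi> x) (\<phi> y) < 1"
    using uc unfolding unif_continuous_def by (meson zero_less_one)
  obtain C where C: "\<And>k. k \<in> carrier G \<Longrightarrow> len k > C \<Longrightarrow> d2 G A \<pi> \<epsilon> k (k \<otimes> g) < \<eta>"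
    using d2_mult_small[OF nontriv(1) \<epsilon> \<eta>] by blast
  have "\<not> {x \<in> S. \<phi> x = \<phi> a} \<subseteq> {x \<in> carrier G. len x \<le> C + len a}"
    using a(2) finite_len_ball finite_subset by blast
  then obtain x where "x \<in> S" "\<phi> x = \<phi> a" "x \<notin> {x \<in> carrier G. len x \<le> C + len a}"
    by blast
  then have x: "x \<in> carrier G" "\<phi> x = \<phi> a" "len x > C + len a"
    by (simp_all add: S_def)
  have a': "a \<in> carrier G" using a by (simp add: S_def)
  define k where "k = x \<otimes> inv a"
  have k: "k \<in> carrier G" "\<phi> k = \<one>" "len k > C"
    using x a' len_mult_ge[of x "inv a"] by (auto simp: k_def)
  then have "d2 G A \<pi> \<epsilon> (\<phi> k) (\<phi> (k \<otimes> g)) < 1"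
    using C close nontriv by blast
  then show False
    using k nontriv d2_one_ge[of "\<phi> g" \<epsilon>] by simp
qed

definition fixed_ray :: "('a \<times> bool) stream \<Rightarrow> bool"
  where "fixed_ray s \<longleftrightarrow> is_ray s \<and> tends (\<lambda>n. \<phi> (ray s n)) s"

lemma fixed_ray_of_Fix:
  assumes ext: "continuous_extension G A \<pi> R (nf_endo G A \<pi> R \<phi>) \<Phi>"
    and \<alpha>: "\<alpha> \<in> Fix (Lhat G A \<pi> R) \<Phi> \<inter> boundary G A \<pi> R"
  shows "\<exists>s. \<alpha> = InfWord s \<and> fixed_ray s"
proof -
  obtain s where s: "\<alpha> = InfWord s" "is_ray s" using \<alpha> by (auto simp: boundary_iff)
  have "limitin (Lhat_topology G A \<pi> R) (\<lambda>n. FinWord (nfw (\<phi> (ray s n)))) (\<Phi> (InfWord s)) sequentially"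
    by (intro limitin_continuous_extension[OF ext s(2)]) (simp add: nf_endo_def)
  moreover have "\<Phi> (InfWord s) = InfWord s" using \<alpha> s by (simp add: Fix_def)
  ultimately have "tends (\<lambda>n. \<phi> (ray s n)) s"
    using limitin_iff_tends[OF s(2), of "\<lambda>n. \<phi> (ray s n)"] s(2) by simp
  then show ?thesis using s by (simp add: fixed_ray_def)
qed

end

section \<open>Bounded cancellation along fixed rays\<close>

locale proper_endo = short_nf_endo G A \<pi> N\<^sub>0 R \<phi>
  for G :: "('g, 'm) monoid_scheme" (structure)
    and A :: "'a set" and \<pi> N\<^sub>0 R \<phi> +
  assumes proper: "\<And>r. \<exists>C. \<forall>x\<in>carrier G. len (\<phi> x) \<le> r \<longrightarrow> len x \<le> C"
begin

text \<open>A Lipschitz constant of \<phi> for the word metric. The sum bounds each of its terms and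
  makes sense for an empty alphabet too.\<close>

definition K :: nat where "K = (\<Sum>x\<in>letters A. len (\<phi> (\<pi> [x])))"

text \<open>The radius \<open>2 * (N * K)\<close> bounds the distance of two images that lie in one
  branch, each within \<open>N * K\<close> of its root.\<close>

definition C\<^sub>0 :: nat
  where "C\<^sub>0 = (SOME C. \<forall>x\<in>carrier G. len (\<phi> x) \<le> 2 * (N * K) \<longrightarrow> len x \<le> C)"

lemma C0: "x \<in> carrier G \<Longrightarrow> len (\<phi> x) \<le> 2 * (N * K) \<Longrightarrow> len x \<le> C\<^sub>0"
  using someI_ex[OF proper[of "2 * (N * K)"]] unfolding C\<^sub>0_def by blast

lemma len_phi_letter: "x \<in> letters A \<Longrightarrow> len (\<phi> (\<pi> [x])) \<le> K"
  unfolding K_def using finite_letters by (intro member_le_sum) auto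

lemma len_phi_pi: "u \<in> words A \<Longrightarrow> len (\<phi> (\<pi> u)) \<le> K * length u"
proof (induction u)
  case (Cons x u)
  then have "\<phi> (\<pi> (x # u)) = \<phi> (\<pi> [x]) \<otimes> \<phi> (\<pi> u)"
    using pi_append[of "[x]" u] by simp
  then have "len (\<phi> (\<pi> (x # u))) \<le> len (\<phi> (\<pi> [x])) + len (\<phi> (\<pi> u))"
    using Cons.prems len_mult by simp
  moreover have "len (\<phi> (\<pi> u)) \<le> K * length u" using Cons by auto
  ultimately show ?case using len_phi_letter[of x] Cons.prems by simp
qed simp

lemma len_phi: "x \<in> carrier G \<Longrightarrow> len (\<phi> x) \<le> K * len x"
  using len_phi_pi[of "nfw x"] by (simp add: len_def)

lemma phi_ray_step:
  assumes "is_ray s"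
  shows "len (inv (\<phi> (ray s n)) \<otimes> \<phi> (ray s (Suc n))) \<le> K"
  using assms len_phi_letter[OF ray_letter[OF assms, of n]] ray_letter[OF assms, of n]
  by (simp add: ray_Suc inv_mult_cancel)

text \<open>The element \<open>g\<^sub>n\<close> of the overview.\<close>

definition drift :: "('a \<times> bool) stream \<Rightarrow> nat \<Rightarrow> 'g"
  where "drift s n = inv (ray s n) \<otimes> \<phi> (ray s n)"

text \<open>\<open>1 + N * K\<close> is the excess over the ray when the path enters the side
  branch, and \<open>K * C\<^sub>0\<close> is what the image can gain in the at most
  \<open>C\<^sub>0\<close> steps since then.\<close>

definition B :: nat where "B = 1 + N * K + K * C\<^sub>0"

text \<open>The path \<open>\<phi> (ray s i)\<close> enters the branch at which the normal form of \<open>\<phi> (ray s n)\<close> leaves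
  \<open>s\<close> before time \<open>n\<close> and leaves it after time \<open>n\<close>, both times near its root. By properness
  these two times are close to each other.\<close>

lemma image_near_ray:
  assumes s: "fixed_ray s"
  shows "\<exists>m. take m (nfw (\<phi> (ray s n))) = stake m s \<and> len (\<phi> (ray s n)) \<le> m + B"
proof -
  have r: "is_ray s" using s by (simp add: fixed_ray_def)
  define y where "y n = \<phi> (ray s n)" for n
  have y: "y i \<in> carrier G" "len (inv (y i) \<otimes> y (Suc i)) \<le> K" for i
    using r phi_ray_step by (auto simp: y_def)
  let ?P = "\<lambda>m. take m (nfw (y n)) = stake m s"
  have bound: "m \<le> len (y n)" if "?P m" for m
    using that by (metis length_stake length_take len_def min.cobounded1)
  \<comment> \<open>The length of the longest common prefix of the image and
    \<open>s\<close>.\<close>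
  define m where "m = (GREATEST m. ?P m)"
  have m: "?P m" unfolding m_def
    by (rule GreatestI_nat[of ?P 0 "len (y n)"], simp, rule bound)
  have m': "\<not> ?P (Suc m)"
  proof
    assume "?P (Suc m)"
    then have "Suc m \<le> m" unfolding m_def by (rule Greatest_le_nat) (rule bound)
    then show False by simp
  qed
  define q where "q = take (Suc m) (nfw (y n))"
  have "len (y n) \<le> m + B"
  proof (cases "len (y n) \<le> m")
    case False
    then have q: "length q = Suc m" by (simp add: q_def len_def)
    \<comment> \<open>The path starts at the identity, whose empty normal form lies outside the
      branch.\<close>
    have enter: "take (Suc m) (nfw (y 0)) \<noteq> q" using q by (auto simp: y_def)
    obtain j where j: "j \<le> n" "take (Suc m) (nfw (y j)) = q" "len (y j) < Suc m + N * K"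
      using enter_branch[of y K 0 n "Suc m" q, OF y le0 enter q_def[symmetric]] by blast
    \<comment> \<open>The path converges to \<open>s\<close>, and by maximality of \<open>m\<close>
      the word \<open>q\<close> is no prefix of \<open>s\<close>; hence the branch has to be left
      again.\<close>
    have "\<forall>\<^sub>F i in sequentially. take (Suc m) (nfw (y i)) = stake (Suc m) s"
      using s unfolding fixed_ray_def tends_def y_def by blast
    then obtain M where M: "\<And>i. i \<ge> M \<Longrightarrow> take (Suc m) (nfw (y i)) = stake (Suc m) s"
      unfolding eventually_sequentially by blast
    have leave: "take (Suc m) (nfw (y (n + M))) \<noteq> q" using M[of "n + M"] m' q_def by simp
    obtain k where k: "n \<le> k" "take (Suc m) (nfw (y k)) = q" "len (y k) < Suc m + N * K"
      using leave_branch[of y K n "n + M" "Suc m" q, OF y le_add1 q_def[symmetric] leave] by blast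
    have "len (inv (y j) \<otimes> y k) \<le> 2 * (N * K)"
      using len_same_branch[OF y(1) y(1) trans[OF j(2) k(2)[symmetric]]] j(3) k(3) by linarith
    \<comment> \<open>Properness turns closeness of the images into closeness of the times
      \<open>j\<close> and \<open>k\<close>, and \<open>n\<close> lies between them.\<close>
    then have "len (inv (ray s j) \<otimes> ray s k) \<le> C\<^sub>0"
      using r by (intro C0) (simp_all add: y_def)
    then have "k - j \<le> C\<^sub>0"
      using len_inv_ray_mult[OF r, of j k] by linarith
    then have "len (inv (ray s j) \<otimes> ray s n) \<le> C\<^sub>0"
      using len_inv_ray_mult[OF r, of j n] j k by linarith
    then have "len (\<phi> (inv (ray s j) \<otimes> ray s n)) \<le> K * C\<^sub>0"
      using r by (intro order_trans[OF len_phi mult_le_mono2]) simp_all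
    then have "len (inv (y j) \<otimes> y n) \<le> K * C\<^sub>0"
      using r by (simp add: y_def)
    then have "len (y n) \<le> len (y j) + K * C\<^sub>0"
      using len_mult[of "y j" "inv (y j) \<otimes> y n"] y(1) by (simp add: mult_inv_cancel)
    then show ?thesis using j by (simp add: B_def)
  qed (simp add: B_def)
  with m show ?thesis by (auto simp: y_def)
qed

text \<open>The index of a vertex of the ray within \<open>B\<close> of the image of the
  \<open>n\<close>-th vertex, if the ray is fixed; any choice serves.\<close>

definition shadow :: "('a \<times> bool) stream \<Rightarrow> nat \<Rightarrow> nat"
  where "shadow s n =
    (SOME m. take m (nfw (\<phi> (ray s n))) = stake m s \<and> len (\<phi> (ray s n)) \<le> m + B)"

lemma shadow_dist:
  assumes s: "fixed_ray s"
  shows "len (inv (ray s (shadow s n)) \<otimes> \<phi> (ray s n)) \<le> B"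
proof -
  have r: "is_ray s" using s by (simp add: fixed_ray_def)
  have *: "take (shadow s n) (nfw (\<phi> (ray s n))) = stake (shadow s n) s \<and>
      len (\<phi> (ray s n)) \<le> shadow s n + B"
    unfolding shadow_def by (rule someI_ex[OF image_near_ray[OF s]])
  then have "\<pi> (take (shadow s n) (nfw (\<phi> (ray s n)))) = ray s (shadow s n)"
    by (simp only: ray_def)
  moreover have "\<phi> (ray s n) \<in> carrier G" using r by simp
  ultimately have "len (inv (ray s (shadow s n)) \<otimes> \<phi> (ray s n)) = len (\<phi> (ray s n)) - shadow s n"
    using len_inv_pi_take[of "\<phi> (ray s n)" "shadow s n"] by metis
  then show ?thesis using conjunct2[OF *] by linarith
qed

text \<open>Pass from one shadow to the next through the two images, at cost
  \<open>B + K + B\<close>; on a geodesic ray distance is difference of indices.\<close>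

lemma shadow_step:
  assumes s: "fixed_ray s"
  shows "\<bar>int (shadow s (Suc n)) - int (shadow s n)\<bar> \<le> int (2 * B + K)"
proof -
  have r: "is_ray s" using s by (simp add: fixed_ray_def)
  let ?a = "ray s (shadow s n)" and ?b = "ray s (shadow s (Suc n))"
    and ?x = "\<phi> (ray s n)" and ?y = "\<phi> (ray s (Suc n))"
  have "len (inv ?a \<otimes> ?b) \<le> len (inv ?a \<otimes> ?x) + len (inv ?x \<otimes> ?b)"
    using r by (intro len_triangle) auto
  also have "len (inv ?x \<otimes> ?b) \<le> len (inv ?x \<otimes> ?y) + len (inv ?y \<otimes> ?b)"
    using r by (intro len_triangle) auto
  also have "len (inv ?y \<otimes> ?b) = len (inv ?b \<otimes> ?y)"
    using r by (intro len_inv_mult_commute) auto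
  finally have "len (inv ?a \<otimes> ?b) \<le> 2 * B + K"
    using shadow_dist[OF s, of n] shadow_dist[OF s, of "Suc n"] phi_ray_step[OF r, of n] by linarith
  then show ?thesis using len_inv_ray_mult[OF r, of "shadow s n" "shadow s (Suc n)"] by linarith
qed

section \<open>Long drift: attracting and repelling behaviour\<close>

lemma drift_split:
  assumes s: "fixed_ray s"
  shows "drift s n = (inv (ray s n) \<otimes> ray s (shadow s n)) \<otimes> (inv (ray s (shadow s n)) \<otimes> \<phi> (ray s n))"
  using s by (simp add: drift_def fixed_ray_def inv_mult_telescope)

lemma len_drift_le:
  assumes s: "fixed_ray s"
  shows "int (len (drift s n)) \<le> \<bar>int (shadow s n) - int n\<bar> + int B"
proof -
  have r: "is_ray s" using s by (simp add: fixed_ray_def)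
  have "len (drift s n) \<le> len (inv (ray s n) \<otimes> ray s (shadow s n)) + B"
    using shadow_dist[OF s, of n] r
      len_mult[of "inv (ray s n) \<otimes> ray s (shadow s n)" "inv (ray s (shadow s n)) \<otimes> \<phi> (ray s n)"]
    by (simp add: drift_split[OF s])
  then show ?thesis using len_inv_ray_mult[OF r, of n "shadow s n"] by linarith
qed

lemma drift_closed [simp, intro]: "is_ray s \<Longrightarrow> drift s n \<in> carrier G"
  by (simp add: drift_def)

text \<open>Later drifts depend only on the present one and on the letters to come, not on the past
  of the ray. This makes tails of different rays comparable.\<close>

lemma drift_add:
  assumes "is_ray s"
  shows "drift s (n + i) = inv (ray (sdrop n s) i) \<otimes> drift s n \<otimes> \<phi> (ray (sdrop n s) i)"
  using assms by (simp add: drift_def ray_add is_ray_sdrop inv_mult_group m_assoc)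

text \<open>A drift longer than \<open>D\<close> puts the shadow more than
  \<open>2 * B + K + 1 + N * B\<close> away from \<open>n\<close>: too far to change sides in one
  step, and far enough to protect the first letter of the drift. The bracket is the bound violated
  in the repelling case of \<open>tails_eq\<close>.\<close>

definition D :: nat where "D = 3 * B + K + N * B + 1 + (N * K + K * (N * C\<^sub>0))"

lemma shadow_far:
  assumes "fixed_ray s" "len (drift s n) > D"
  shows "\<bar>int (shadow s n) - int n\<bar> > int (2 * B + K + 1 + N * B)"
proof -
  have "2 * B + K + 1 + N * B + B < len (drift s n)"
    using assms(2) unfolding D_def by linarith
  then have "int (2 * B + K + 1 + N * B) + int B < int (len (drift s n))"
    by linarith
  then show ?thesis using len_drift_le[OF assms(1), of n] by linarith
qed

text \<open>The difference of \<open>shadow s l\<close> and \<open>l\<close> moves by at most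
  \<open>2 * B + K + 1\<close> per step while its absolute value stays above that, so it cannot
  change sign.\<close>

lemma shadow_side_persists:
  assumes "fixed_ray s" "\<And>l. l \<ge> n \<Longrightarrow> len (drift s l) > D" "n \<le> l"
  shows "shadow s l > l \<longleftrightarrow> shadow s n > n"
  using assms(3)
proof (induction l rule: dec_induct)
  case (step l)
  have "int (2 * B + K + 1) \<le> int (2 * B + K + 1 + N * B)" by simp
  moreover have "\<bar>int (shadow s l) - int l\<bar> > int (2 * B + K + 1 + N * B)"
    "\<bar>int (shadow s (Suc l)) - int (Suc l)\<bar> > int (2 * B + K + 1 + N * B)"
    using step.hyps by (intro shadow_far assms; simp)+
  ultimately have "\<bar>int (shadow s l) - int l\<bar> > int (2 * B + K + 1)"
    "\<bar>int (shadow s (Suc l)) - int (Suc l)\<bar> > int (2 * B + K + 1)" by linarith+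
  then have "shadow s (Suc l) > Suc l \<longleftrightarrow> shadow s l > l"
    using shadow_step[OF assms(1), of l] by linarith
  then show ?case using step.IH by simp
qed simp

text \<open>The drift is the ray segment to the shadow times an error of length at most
  \<open>B\<close>, and the segment is long enough for its first letter to survive.\<close>

lemma drift_first_letter:
  assumes s: "fixed_ray s" and far: "len (drift s l) > D"
  shows "take 1 (nfw (drift s l)) = take 1 (nfw (inv (ray s l) \<otimes> ray s (shadow s l)))"
  unfolding drift_split[OF s]
proof (rule nfw_stable)
  have r: "is_ray s" using s by (simp add: fixed_ray_def)
  show "inv (ray s l) \<otimes> ray s (shadow s l) \<in> carrier G"
    "inv (ray s (shadow s l)) \<otimes> \<phi> (ray s l) \<in> carrier G" using r by auto
  have "N * len (inv (ray s (shadow s l)) \<otimes> \<phi> (ray s l)) \<le> N * B"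
    using shadow_dist[OF s] by simp
  moreover have "int (len (inv (ray s l) \<otimes> ray s (shadow s l))) > int (2 * B + K + 1 + N * B)"
    using shadow_far[OF s far] len_inv_ray_mult[OF r, of l "shadow s l"] by simp
  ultimately show "1 + N * len (inv (ray s (shadow s l)) \<otimes> \<phi> (ray s l))
      \<le> len (inv (ray s l) \<otimes> ray s (shadow s l))" by linarith
qed

lemma drift_attracting:
  assumes s: "fixed_ray s" and far: "len (drift s l) > D" and side: "shadow s l > l"
  shows "take 1 (nfw (drift s l)) = [s !! l]"
proof -
  have r: "is_ray s" using s by (simp add: fixed_ray_def)
  define j where "j = shadow s l - l"
  have "shadow s l = l + j" "j \<ge> 1" using side by (auto simp: j_def)
  then show ?thesis
    unfolding drift_first_letter[OF s far]
    by (simp add: inv_ray_mult r nfw_ray is_ray_sdrop take_stake min_def)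
qed

text \<open>If the drift began with the next letter of the ray, stepping from vertex
  \<open>l\<close> to \<open>Suc l\<close> would approach the shadow; but the shadow is not ahead,
  so the step moves away from it.\<close>

lemma drift_repelling:
  assumes s: "fixed_ray s" and far: "len (drift s l) > D" and side: "\<not> shadow s l > l"
  shows "take 1 (nfw (drift s l)) \<noteq> [s !! l]"
proof
  assume *: "take 1 (nfw (drift s l)) = [s !! l]"
  have r: "is_ray s" using s by (simp add: fixed_ray_def)
  define x where "x = inv (ray s l) \<otimes> ray s (shadow s l)"
  have x: "x \<in> carrier G" using r by (simp add: x_def)
  have "take 1 (nfw x) = [s !! l]" using drift_first_letter[OF s far] * by (simp add: x_def)
  then have "len (inv (\<pi> [s !! l]) \<otimes> x) = len x - 1"
    using len_inv_pi_take[OF x, of 1] by simp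
  moreover have "inv (\<pi> [s !! l]) \<otimes> x = inv (ray s (Suc l)) \<otimes> ray s (shadow s l)"
    using r ray_letter[OF r, of l] by (simp add: ray_Suc x_def inv_mult_group m_assoc)
  ultimately show False
    using len_inv_ray_mult[OF r, of l "shadow s l"] len_inv_ray_mult[OF r, of "Suc l" "shadow s l"] side
    by (simp add: x_def)
qed

text \<open>Seen from vertex \<open>l\<close>, the images of the later vertices start at the drift,
  outside the branch of the letter \<open>s !! l\<close>, and converge to the tail of
  \<open>s\<close>, inside it. They enter near the root, which is close to the identity.\<close>

lemma image_path_visits:
  assumes s: "fixed_ray s" and e: "take 1 (nfw (drift s l)) \<noteq> [s !! l]"
  shows "\<exists>i. len (drift s l \<otimes> \<phi> (ray (sdrop l s) i)) \<le> N * K"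
proof -
  have r: "is_ray s" using s by (simp add: fixed_ray_def)
  define x where "x i = inv (ray s l) \<otimes> \<phi> (ray s (l + i))" for i
  have x_eq: "x i = drift s l \<otimes> \<phi> (ray (sdrop l s) i)" for i
    using r by (simp add: x_def drift_def ray_add is_ray_sdrop m_assoc)
  have step: "len (inv (x i) \<otimes> x (Suc i)) \<le> K" for i
    using phi_ray_step[OF r, of "l + i"] r
    by (simp add: x_def inv_mult_group m_assoc mult_inv_cancel)
  have closed: "x i \<in> carrier G" for i using r by (simp add: x_def)
  have "tends (\<lambda>i. \<phi> (ray s (l + i))) s"
    using s tends_offset[of "\<lambda>i. \<phi> (ray s i)" l s] by (simp add: fixed_ray_def)
  then have "tends x (lim_mult (inv (ray s l)) s)"
    unfolding x_def using r by (intro tends_mult) auto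
  then have "\<forall>\<^sub>F i in sequentially. take 1 (nfw (x i)) = stake 1 (sdrop l s)"
    unfolding lim_mult_inv_ray[OF r] tends_def by blast
  then obtain b where "take 1 (nfw (x b)) = [s !! l]"
    unfolding eventually_sequentially by auto
  moreover have "take 1 (nfw (x 0)) \<noteq> [s !! l]"
    using e x_eq[of 0] r by simp
  ultimately obtain i where "len (x i) < 1 + N * K"
    using enter_branch[of x K 0 b 1 "[s !! l]"] closed step by blast
  then show ?thesis using x_eq by (intro exI[of _ i]) simp
qed

text \<open>Where two such rays part, the element \<open>e\<close> by which \<open>\<phi>\<close> displaces the branching point
  determines the next letter in the attracting case. In the repelling case the images of both
  tails pass near the identity, so by properness they do so early, and \<open>e\<close> is short.\<close>

lemma tails_eq:
  assumes s: "fixed_ray s" and t: "fixed_ray t"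
    and far_s: "\<And>l. l \<ge> n \<Longrightarrow> len (drift s l) > D"
    and far_t: "\<And>l. l \<ge> m \<Longrightarrow> len (drift t l) > D"
    and drift: "drift s n = drift t m"
    and side: "shadow s n > n \<longleftrightarrow> shadow t m > m"
  shows "sdrop n s = sdrop m t"
proof (rule ccontr)
  assume "sdrop n s \<noteq> sdrop m t"
  then have ex: "\<exists>i. sdrop n s !! i \<noteq> sdrop m t !! i"
    by (metis ext stream_smap_nats)
  define i where "i = (LEAST i. sdrop n s !! i \<noteq> sdrop m t !! i)"
  have i: "sdrop n s !! i \<noteq> sdrop m t !! i"
    unfolding i_def by (rule LeastI_ex[OF ex])
  have before: "sdrop n s !! j = sdrop m t !! j" if "j < i" for j
    using not_less_Least[of j "\<lambda>i. sdrop n s !! i \<noteq> sdrop m t !! i"] that unfolding i_def by blast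
  have r: "is_ray s" "is_ray t" using s t by (auto simp: fixed_ray_def)
  have "stake i (sdrop n s) = stake i (sdrop m t)"
    by (rule nth_equalityI) (auto simp: before)
  then have "ray (sdrop n s) i = ray (sdrop m t) i" by (simp add: ray_def)
  \<comment> \<open>The tails agree up to \<open>i\<close>, so \<open>drift_add\<close> yields the
    same drift at the branching point.\<close>
  then have e: "drift s (n + i) = drift t (m + i)"
    using drift r by (simp add: drift_add)
  have letters: "s !! (n + i) \<noteq> t !! (m + i)"
    using i by (simp add: sdrop_snth)
  have far: "len (drift s (n + i)) > D" "len (drift t (m + i)) > D"
    using far_s far_t by auto
  note sides = shadow_side_persists[OF s far_s le_add1[of n i]]
    shadow_side_persists[OF t far_t le_add1[of m i]]
  show False
  proof (cases "shadow s n > n")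
    case True
    then show False
      using drift_attracting[OF s far(1)] drift_attracting[OF t far(2)] sides side e letters
      by (metis list.inject)
  next
    case False
    then have "take 1 (nfw (drift s (n + i))) \<noteq> [s !! (n + i)]"
      "take 1 (nfw (drift t (m + i))) \<noteq> [t !! (m + i)]"
      using drift_repelling[OF s far(1)] drift_repelling[OF t far(2)] sides side by blast+
    then obtain j j' where
      j: "len (drift s (n + i) \<otimes> \<phi> (ray (sdrop (n + i) s) j)) \<le> N * K" and
      j': "len (drift t (m + i) \<otimes> \<phi> (ray (sdrop (m + i) t) j')) \<le> N * K"
      using image_path_visits[OF s] image_path_visits[OF t] by metis
    define x where "x = ray (sdrop (n + i) s) j"
    define y where "y = ray (sdrop (m + i) t) j'"
    define d where "d = drift s (n + i)"
    have closed: "x \<in> carrier G" "y \<in> carrier G" "d \<in> carrier G"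
      using r by (auto simp: x_def y_def d_def is_ray_sdrop)
    have "inv (d \<otimes> \<phi> x) \<otimes> (d \<otimes> \<phi> y) = \<phi> (inv x \<otimes> y)"
      using closed by (simp add: inv_mult_group m_assoc inv_mult_cancel)
    then have "len (\<phi> (inv x \<otimes> y)) \<le> len (d \<otimes> \<phi> x) + len (d \<otimes> \<phi> y)"
      using len_mult[of "inv (d \<otimes> \<phi> x)" "d \<otimes> \<phi> y"] closed by simp
    then have "len (\<phi> (inv x \<otimes> y)) \<le> 2 * (N * K)"
      using j j' e by (simp add: x_def y_def d_def)
    then have xy: "len (inv x \<otimes> y) \<le> C\<^sub>0" using closed by (intro C0) auto
    \<comment> \<open>A longer \<open>x\<close> would share its first letter with the nearby
      \<open>y\<close>, yet the two tails begin with different letters.\<close>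
    have "len x \<le> N * C\<^sub>0"
    proof (rule ccontr)
      assume "\<not> len x \<le> N * C\<^sub>0"
      moreover have "N * len (inv x \<otimes> y) \<le> N * C\<^sub>0" using xy by simp
      ultimately have "1 + N * len (inv x \<otimes> y) \<le> len x" by linarith
      then have "take 1 (nfw y) = take 1 (nfw x)" and "len x \<ge> 1"
        using nfw_stable[of x "inv x \<otimes> y" 1] closed by (auto simp: mult_inv_cancel)
      moreover have "nfw x = stake j (sdrop (n + i) s)" "nfw y = stake j' (sdrop (m + i) t)"
        using r by (auto simp: x_def y_def nfw_ray is_ray_sdrop)
      ultimately have "take 1 (stake j' (sdrop (m + i) t)) = take 1 (stake j (sdrop (n + i) s))" "j \<ge> 1"
        by (auto simp: len_def)
      then show False
        using letters by (cases j; cases j') auto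
    qed
    then have "len (\<phi> x) \<le> K * (N * C\<^sub>0)"
      by (intro order_trans[OF len_phi[OF closed(1)] mult_le_mono2])
    then have "len d \<le> N * K + K * (N * C\<^sub>0)"
      using len_mult_ge[of d "\<phi> x"] closed j by (simp add: d_def x_def)
    then show False using far(1) by (simp add: d_def D_def)
  qed
qed

section \<open>Regular points and their orbits\<close>

lemma fix_of_drift_eq:
  assumes "is_ray s" "is_ray t" "drift s n = drift t m"
  shows "ray t m \<otimes> inv (ray s n) \<in> Fix (carrier G) \<phi>"
proof -
  have "\<phi> (ray t m) = ray t m \<otimes> (inv (ray s n) \<otimes> \<phi> (ray s n))"
    using assms by (simp add: drift_def mult_inv_cancel)
  then show ?thesis using assms by (simp add: Fix_def m_assoc)
qed

text \<open>A finite ball forces infinitely many times \<open>n\<close> with the drift of one time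
  \<open>m\<close>. The elements \<open>ray s n \<otimes> inv (ray s m)\<close> are fixed, and by
  \<open>nfw_stable\<close> they share ever longer prefixes with \<open>s\<close>.\<close>

lemma bounded_drift_singular:
  assumes r: "is_ray s" and inf: "infinite {n. len (drift s n) \<le> E}"
  shows "InfWord s \<in> Lhat_topology G A \<pi> R closure_of (FinWord ` Fix L (nf_endo G A \<pi> R \<phi>))"
proof -
  have "finite (drift s ` {n. len (drift s n) \<le> E})"
    by (rule finite_subset[OF _ finite_len_ball[of E]]) (use r in auto)
  then obtain m where m: "infinite {n \<in> {n. len (drift s n) \<le> E}. drift s n = drift s m}"
    using pigeonhole_infinite[OF inf] by blast
  have "\<exists>y\<in>FinWord ` Fix L (nf_endo G A \<pi> R \<phi>). y \<in> completion.mball (InfWord s) e" if e: "e > 0" for e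
  proof -
    obtain k where k: "(1 / 2) ^ k < e"
      using real_arch_pow_inv[of e "1 / 2"] e by auto
    \<comment> \<open>Right multiplication by the inverse of \<open>ray s m\<close> affects at most
      \<open>N * m\<close> letters, which leaves \<open>Suc k\<close> of them intact.\<close>
    obtain n where n: "n \<ge> Suc k + N * m" "drift s n = drift s m"
      using m unfolding infinite_nat_iff_unbounded_le by blast
    define x where "x = ray s n \<otimes> inv (ray s m)"
    have x: "x \<in> carrier G" "\<phi> x = x"
      using fix_of_drift_eq[OF r r n(2)[symmetric]] r by (auto simp: x_def Fix_def)
    have "take (Suc k) (nfw x) = take (Suc k) (nfw (ray s n))"
      unfolding x_def using r n by (intro nfw_stable) (auto simp: len_ray)
    also have "\<dots> = stake (Suc k) s"
      using n r by (simp add: nfw_ray take_stake min_def del: stake.simps)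
    finally have "d3 (InfWord s) (FinWord (nfw x)) < (1 / 2) ^ k"
      by (intro d3_InfWord_lessI) (simp only: prefix_of_stake_FinWord)
    then have "FinWord (nfw x) \<in> completion.mball (InfWord s) e"
      using r x k by (auto simp: Lhat_iff)
    moreover have "nfw x \<in> Fix L (nf_endo G A \<pi> R \<phi>)"
      using x by (simp add: Fix_def nf_endo_def)
    ultimately show ?thesis by blast
  qed
  then show ?thesis
    using r unfolding Lhat_topology_def completion.metric_closure_of by (auto simp: Lhat_iff)
qed

text \<open>Take the time after the last one with drift of length at most \<open>D\<close>; time 0
  is a candidate since the drift there is trivial. A single step adds at most \<open>1 + K\<close>
  to the length.\<close>

lemma regular_departure:
  assumes s: "fixed_ray s"
    and reg: "InfWord s \<notin> Lhat_topology G A \<pi> R closure_of (FinWord ` Fix L (nf_endo G A \<pi> R \<phi>))"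
  shows "\<exists>n. (\<forall>l\<ge>n. len (drift s l) > D) \<and> len (drift s n) \<le> D + 1 + K"
proof -
  have r: "is_ray s" using s by (simp add: fixed_ray_def)
  have "finite {n. len (drift s n) \<le> D}"
    using bounded_drift_singular[OF r] reg by blast
  moreover have "0 \<in> {n. len (drift s n) \<le> D}" by (simp add: drift_def)
  ultimately obtain n where n: "len (drift s n) \<le> D" "\<And>l. len (drift s l) \<le> D \<Longrightarrow> l \<le> n"
    using Max_in[of "{n. len (drift s n) \<le> D}"] Max_ge[of "{n. len (drift s n) \<le> D}"] by blast
  have l: "s !! n \<in> letters A" using ray_letter[OF r] .
  have "drift s (Suc n) = inv (\<pi> [s !! n]) \<otimes> drift s n \<otimes> \<phi> (\<pi> [s !! n])"
    using r l by (simp add: drift_def ray_Suc inv_mult_group m_assoc)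
  then have "len (drift s (Suc n)) \<le> len (inv (\<pi> [s !! n])) + len (drift s n) + len (\<phi> (\<pi> [s !! n]))"
    using r l len_mult[of "inv (\<pi> [s !! n]) \<otimes> drift s n" "\<phi> (\<pi> [s !! n])"]
      len_mult[of "inv (\<pi> [s !! n])" "drift s n"] by simp
  then have "len (drift s (Suc n)) \<le> D + 1 + K"
    using len_letter[OF l] len_phi_letter[OF l] l n(1) by simp
  moreover have "len (drift s l) > D" if "l \<ge> Suc n" for l
    using n(2)[of l] that by linarith
  ultimately show ?thesis by blast
qed

text \<open>The fixed element \<open>h\<close> carries vertex \<open>n\<close> of \<open>s\<close>
  to vertex \<open>m\<close> of \<open>t\<close>, and with it the common tail.\<close>

lemma orbit_eq:
  assumes s: "fixed_ray s" and t: "fixed_ray t"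
    and drift: "drift s n = drift t m" and tails: "sdrop n s = sdrop m t"
  shows "orbit (G\<lparr>carrier := Fix (carrier G) \<phi>\<rparr>) (act G A \<pi> R) (InfWord s) =
    orbit (G\<lparr>carrier := Fix (carrier G) \<phi>\<rparr>) (act G A \<pi> R) (InfWord t)"
proof -
  have r: "is_ray s" "is_ray t" using s t by (auto simp: fixed_ray_def)
  define h where "h = ray t m \<otimes> inv (ray s n)"
  have h: "h \<in> Fix (carrier G) \<phi>" "h \<in> carrier G"
    using fix_of_drift_eq[OF r drift] by (auto simp: h_def Fix_def)
  have "lim_mult h s = lim_mult (ray t m) (lim_mult (inv (ray s n)) s)"
    using r by (simp add: h_def lim_mult_mult)
  also have "\<dots> = lim_mult (ray t m) (lim_mult (inv (ray t m)) t)"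
    using r tails by (simp add: lim_mult_inv_ray)
  also have "\<dots> = t"
    using r by (simp add: lim_mult_mult lim_mult_one)
  finally have ht: "lim_mult h s = t" .
  have "lim_mult (inv h) t = lim_mult (inv h) (lim_mult h s)" by (simp only: ht)
  also have "\<dots> = s" using r h by (simp add: lim_mult_mult lim_mult_one)
  finally have hs: "lim_mult (inv h) t = s" .
  have incl: "orbit (G\<lparr>carrier := Fix (carrier G) \<phi>\<rparr>) (act G A \<pi> R) (InfWord b) \<subseteq>
      orbit (G\<lparr>carrier := Fix (carrier G) \<phi>\<rparr>) (act G A \<pi> R) (InfWord a)"
    if "is_ray a" "is_ray b" "k \<in> Fix (carrier G) \<phi>" "lim_mult k a = b" for a b k
  proof
    fix \<alpha> assume "\<alpha> \<in> orbit (G\<lparr>carrier := Fix (carrier G) \<phi>\<rparr>) (act G A \<pi> R) (InfWord b)"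
    then obtain g where g: "g \<in> Fix (carrier G) \<phi>" "\<alpha> = act G A \<pi> R g (InfWord b)"
      by (auto simp: orbit_def)
    have c: "g \<in> carrier G" "k \<in> carrier G" using g that by (auto simp: Fix_def)
    have "lim_mult g b = lim_mult (g \<otimes> k) a"
      using lim_mult_mult[OF c that(1)] that(4) by simp
    then have "\<alpha> = act G A \<pi> R (g \<otimes> k) (InfWord a)"
      using g(2) c that(1,2) by (simp add: act_InfWord)
    moreover have "g \<otimes> k \<in> Fix (carrier G) \<phi>"
      using g that by (auto simp: Fix_def)
    ultimately show "\<alpha> \<in> orbit (G\<lparr>carrier := Fix (carrier G) \<phi>\<rparr>) (act G A \<pi> R) (InfWord a)"
      by (auto simp: orbit_def)
  qed
  have "inv h \<in> Fix (carrier G) \<phi>" using h by (simp add: Fix_def)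
  then show ?thesis
    using incl[OF r h(1) ht] incl[OF r(2,1) _ hs] by blast
qed

text \<open>Each regular point gets a key: its drift at a departure time, which lies in a finite
  ball, and the side of its shadow. By \<open>tails_eq\<close> and \<open>orbit_eq\<close>, equal
  keys give equal orbits.\<close>

lemma finite_orbits_Reg:
  assumes ext: "continuous_extension G A \<pi> R (nf_endo G A \<pi> R \<phi>) \<Phi>"
  shows "finite (orbits (G\<lparr>carrier := Fix (carrier G) \<phi>\<rparr>) (Reg G A \<pi> R \<phi> \<Phi>) (act G A \<pi> R))"
proof -
  let ?orb = "orbit (G\<lparr>carrier := Fix (carrier G) \<phi>\<rparr>) (act G A \<pi> R)"
  let ?S = "Reg G A \<pi> R \<phi> \<Phi>"
  define P where "P \<alpha> \<kappa> \<longleftrightarrow> (\<exists>s n. \<alpha> = InfWord s \<and> fixed_ray s \<and> (\<forall>l\<ge>n. len (drift s l) > D) \<and>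
    len (drift s n) \<le> D + 1 + K \<and> \<kappa> = (drift s n, shadow s n > n))" for \<alpha> \<kappa>
  have "\<exists>\<kappa>. P \<alpha> \<kappa>" if \<alpha>: "\<alpha> \<in> ?S" for \<alpha>
  proof -
    obtain s where s: "\<alpha> = InfWord s" "fixed_ray s"
      using fixed_ray_of_Fix[OF ext, of \<alpha>] \<alpha> unfolding Reg_def by blast
    then obtain n where "\<forall>l\<ge>n. len (drift s l) > D" "len (drift s n) \<le> D + 1 + K"
      using regular_departure[OF s(2)] \<alpha> unfolding Reg_def by blast
    with s show ?thesis unfolding P_def by blast
  qed
  then obtain \<kappa> where \<kappa>: "\<And>\<alpha>. \<alpha> \<in> ?S \<Longrightarrow> P \<alpha> (\<kappa> \<alpha>)" by metis
  have "\<kappa> ` ?S \<subseteq> {x \<in> carrier G. len x \<le> D + 1 + K} \<times> UNIV"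
  proof
    fix c assume "c \<in> \<kappa> ` ?S"
    then obtain \<alpha> where "P \<alpha> c" using \<kappa> by blast
    then show "c \<in> {x \<in> carrier G. len x \<le> D + 1 + K} \<times> UNIV"
      by (auto simp: P_def fixed_ray_def)
  qed
  then have fin: "finite (\<kappa> ` ?S)"
    by (rule finite_subset) (simp add: finite_len_ball)
  have same: "?orb \<alpha> = ?orb \<beta>"
    if S: "\<alpha> \<in> ?S" "\<beta> \<in> ?S" and key: "\<kappa> \<alpha> = \<kappa> \<beta>" for \<alpha> \<beta>
  proof -
    obtain s n where s: "\<alpha> = InfWord s" "fixed_ray s" "\<And>l. l \<ge> n \<Longrightarrow> len (drift s l) > D"
      "\<kappa> \<alpha> = (drift s n, shadow s n > n)"
      using \<kappa>[OF S(1)] unfolding P_def by blast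
    obtain t m where t: "\<beta> = InfWord t" "fixed_ray t" "\<And>l. l \<ge> m \<Longrightarrow> len (drift t l) > D"
      "\<kappa> \<beta> = (drift t m, shadow t m > m)"
      using \<kappa>[OF S(2)] unfolding P_def by blast
    have eq: "drift s n = drift t m" "shadow s n > n \<longleftrightarrow> shadow t m > m"
      using s(4) t(4) key by simp_all
    have "sdrop n s = sdrop m t"
      by (rule tails_eq[OF s(2) t(2) s(3) t(3) eq])
    then show ?thesis
      using orbit_eq[OF s(2) t(2) eq(1)] s(1) t(1) by simp
  qed
  \<comment> \<open>One representative per key already produces all orbits.\<close>
  have "?orb \<alpha> = ?orb (inv_into ?S \<kappa> (\<kappa> \<alpha>))" if "\<alpha> \<in> ?S" for \<alpha>
    using that inv_into_into[of "\<kappa> \<alpha>" \<kappa> ?S] f_inv_into_f[of "\<kappa> \<alpha>" \<kappa> ?S]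
    by (intro same) auto
  then have "?orb ` ?S \<subseteq> (\<lambda>c. ?orb (inv_into ?S \<kappa> c)) ` \<kappa> ` ?S"
    by blast
  then have "finite (?orb ` ?S)"
    using fin finite_subset by blast
  moreover have "orbits (G\<lparr>carrier := Fix (carrier G) \<phi>\<rparr>) ?S (act G A \<pi> R) = ?orb ` ?S"
    by (auto simp: orbits_def)
  ultimately show ?thesis by simp
qed

end

theorem theorem8p5:
  fixes G :: "('g, 'm) monoid_scheme"
    and A :: "'a set"
    and \<pi> :: "('a \<times> bool) list \<Rightarrow> 'g"
    and N\<^sub>0 :: nat
    and R :: "(('a \<times> bool) \<times> ('a \<times> bool)) set"
    and \<delta> \<epsilon> :: real
    and \<phi> :: "'g \<Rightarrow> 'g"
    and \<Phi> :: "('a \<times> bool) fiword \<Rightarrow> ('a \<times> bool) fiword"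
  assumes "group G" and "finitely_generated G" and "virtually_free G"
    and "finite A" and "matched_epi G A \<pi>"
    and "N\<^sub>0 > 0" and "bounded_reduction G A \<pi> N\<^sub>0"
    and "linear_order_on (letters A) R"
    and "\<delta> \<ge> 0" and "hyperbolic G A \<pi> \<delta>"
    and "\<epsilon> > 0" and "\<epsilon> * \<delta> \<le> 1 / 5"
    and "\<phi> \<in> hom G G"
    and "unif_continuous (carrier G) (d2 G A \<pi> \<epsilon>) \<phi>"
    and "continuous_extension G A \<pi> R (nf_endo G A \<pi> R \<phi>) \<Phi>"
  shows "finite (orbits (G\<lparr>carrier := Fix (carrier G) \<phi>\<rparr>) (Reg G A \<pi> R \<phi> \<Phi>) (act G A \<pi> R))"
proof -
  interpret short_nf_endo G A \<pi> N\<^sub>0 R \<phi>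
    using assms by (simp add: short_nf_endo_def short_nf_def short_nf_axioms_def short_nf_endo_axioms_def)
  show ?thesis
  proof (cases "\<forall>g\<in>carrier G. \<phi> g = \<one>\<^bsub>G\<^esub>")
    case True
    \<comment> \<open>The trivial endomorphism may fail to be proper, but it fixes no boundary
      point: the images along a ray are constantly the identity, with empty normal form.\<close>
    have "\<not> fixed_ray s" for s
    proof
      assume s: "fixed_ray s"
      then have "\<forall>\<^sub>F n in sequentially. take 1 (nf G A \<pi> R (\<phi> (ray s n))) = stake 1 s"
        unfolding fixed_ray_def tends_def by blast
      moreover have "\<phi> (ray s n) = \<one>\<^bsub>G\<^esub>" for n
        using True s by (simp add: fixed_ray_def)
      ultimately show False by simp
    qed
    then have "Reg G A \<pi> R \<phi> \<Phi> = {}"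
      using fixed_ray_of_Fix[OF assms(15)] unfolding Reg_def by blast
    then show ?thesis by (simp add: orbits_def)
  next
    case False
    then obtain g where "g \<in> carrier G" "\<phi> g \<noteq> \<one>\<^bsub>G\<^esub>" by blast
    then interpret proper_endo G A \<pi> N\<^sub>0 R \<phi>
      using unif_continuous_proper[OF assms(11,14)] by unfold_locales
    show ?thesis by (rule finite_orbits_Reg[OF assms(15)])
  qed
qed

end
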